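(* Let $n\geq 2$ be an integer. If $k$ is an algebraically closed field, then for every integer $d\geq 0$ the set $\mathcal{C}^{d}_n(k)=\{(A,B)\mid d_k(A,B)\leq d\}$ is an affine variety in the $2n^2$-dimensional affine space $\mathrm{Mat}_{n\times n}(k)^2$. Moreover, for an arbitrary field $k$ and every integer $d$ with $0\leq d\leq 2$, the set $\mathcal{C}^{d}_n(k)$ is an affine variety in $\mathrm{Mat}_{n\times n}(k)^2$.
   Context: Let $k$ be a field, $n\ge 2$. $\mathrm{Mat}_{n\times n}(k)$ is the set of $n\times n$ matrices over $k$; $\mathrm{Mat}_{n\times n}(k)^2$ is identified with $k^{2n^2}$. A matrix is scalar if it is a constant multiple of the identity. The commuting graph $\Gamma(\mathrm{Mat}_{n\times n}(k))$ has as vertices the non-scalar $n\times n$ matrices over $k$, with an edge between distinct $A$ and $B$ if and only if $AB=BA$. For non-scalar $A,B$, the commuting distance $d_k(A,B)$ is the graph distance between $A$ and $B$ in this graph (equal to $\infty$ if they lie in different connected components). It is extended to all matrices by $d_k(A,A)=0$ and $d_k(A,B)=d_k(B,A)=1$ whenever $A$ is scalar and $A\neq B$. For an integer $d\ge 0$, $\mathcal{C}^{d}_n(k)=\{(A,B)\in\mathrm{Mat}_{n\times n}(k)^2\mid d_k(A,B)\leq d\}$. An affine variety in $k^N$ is the common zero set in $k^N$ of finitely many polynomials with coefficients in $k$ (it need not be irreducible). *)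

theory Defs
  imports
    "Jordan_Normal_Form.Matrix"
    "Graph_Theory.Arc_Walk"
    "HOL-Library.Poly_Mapping"
    "HOL-Library.Extended_Nat"
    "HOL-Computational_Algebra.Polynomial"
begin

type_synonym 'a mpoly = "(nat \<Rightarrow>\<^sub>0 nat) \<Rightarrow>\<^sub>0 'a"

definition mpoly_vars :: "'a::zero mpoly \<Rightarrow> nat set" where
  "mpoly_vars p = (\<Union>m\<in>Poly_Mapping.keys p. Poly_Mapping.keys m)"

definition mpoly_eval :: "(nat \<Rightarrow> 'a) \<Rightarrow> 'a::comm_semiring_1 mpoly \<Rightarrow> 'a" where
  "mpoly_eval x p =
     (\<Sum>m\<in>Poly_Mapping.keys p. Poly_Mapping.lookup p m *
        (\<Prod>i\<in>Poly_Mapping.keys m. x i ^ Poly_Mapping.lookup m i))"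

definition affine_variety :: "nat \<Rightarrow> 'a::field vec set \<Rightarrow> bool" where
  "affine_variety N V \<longleftrightarrow>
     (\<exists>P :: 'a mpoly set. finite P \<and> (\<forall>p\<in>P. mpoly_vars p \<subseteq> {..<N}) \<and>
        V = {x \<in> carrier_vec N. \<forall>p\<in>P. mpoly_eval (\<lambda>i. x $ i) p = 0})"

definition scalar_mat :: "nat \<Rightarrow> 'a::field mat \<Rightarrow> bool" where
  "scalar_mat n A \<longleftrightarrow> (\<exists>c. A = c \<cdot>\<^sub>m 1\<^sub>m n)"

(* An undirected edge is represented by the two arcs between its end points. *)
definition commuting_graph :: "nat \<Rightarrow> ('a::field mat, 'a mat \<times> 'a mat) pre_digraph" where
  "commuting_graph n =
     \<lparr> verts = {A \<in> carrier_mat n n. \<not> scalar_mat n A},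
       arcs = {(A, B). A \<in> carrier_mat n n \<and> \<not> scalar_mat n A \<and>
                       B \<in> carrier_mat n n \<and> \<not> scalar_mat n B \<and>
                       A \<noteq> B \<and> A * B = B * A},
       tail = fst, head = snd \<rparr>"

lemma wf_commuting_graph: "wf_digraph (commuting_graph n)"
  by unfold_locales (auto simp: commuting_graph_def)

lemma symmetric_commuting_graph: "symmetric (commuting_graph n)"
  by (auto simp: symmetric_conv commuting_graph_def)

(* The infimum of the empty set is \<infinity>, so vertices in different components have distance \<infinity>. *)
definition graph_dist :: "('v, 'e) pre_digraph \<Rightarrow> 'v \<Rightarrow> 'v \<Rightarrow> enat" where
  "graph_dist G u v = (INF p\<in>{p. pre_digraph.awalk G u p v}. enat (length p))"

definition commuting_dist :: "nat \<Rightarrow> 'a::field mat \<Rightarrow> 'a mat \<Rightarrow> enat" where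
  "commuting_dist n A B =
     (if A = B then 0
      else if scalar_mat n A \<or> scalar_mat n B then 1
      else graph_dist (commuting_graph n) A B)"

definition commuting_dist_set :: "nat \<Rightarrow> nat \<Rightarrow> ('a::field mat \<times> 'a mat) set" where
  "commuting_dist_set n d =
     {(A, B). A \<in> carrier_mat n n \<and> B \<in> carrier_mat n n \<and> commuting_dist n A B \<le> enat d}"

(* The identification of pairs of n x n matrices with vectors of length 2 n^2:
   the entries of A row by row, followed by those of B. *)
definition mat_pair_coords :: "nat \<Rightarrow> 'a mat \<times> 'a mat \<Rightarrow> 'a vec" where
  "mat_pair_coords n = (\<lambda>(A, B).
     vec (n\<^sup>2) (\<lambda>i. A $$ (i div n, i mod n)) @\<^sub>v vec (n\<^sup>2) (\<lambda>i. B $$ (i div n, i mod n)))"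

lemma bij_betw_mat_pair_coords:
  "bij_betw (mat_pair_coords n :: 'a mat \<times> 'a mat \<Rightarrow> 'a vec)
     (carrier_mat n n \<times> carrier_mat n n) (carrier_vec (2 * n\<^sup>2))"
proof -
  define g :: "'a vec \<Rightarrow> 'a mat \<times> 'a mat" where
    "g v = (mat n n (\<lambda>(i, j). v $ (i * n + j)), mat n n (\<lambda>(i, j). v $ (n\<^sup>2 + (i * n + j))))" for v
  have lt: "i * n + j < n\<^sup>2" if "i < n" "j < n" for i j
  proof -
    have "i * n + j < Suc i * n" using that by simp
    also have "\<dots> \<le> n * n" using that by (intro mult_le_mono1) simp
    finally show ?thesis by (simp add: power2_eq_square)
  qed
  have dm: "i div n < n" "i mod n < n" if "i < n\<^sup>2" for i
  proof -
    from that have "n > 0" by (cases n) auto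
    then show "i mod n < n" by simp
    from that show "i div n < n"
      unfolding power2_eq_square by (rule less_mult_imp_div_less)
  qed
  have idx: "mat_pair_coords n (A, B) $ i =
      (if i < n\<^sup>2 then A $$ (i div n, i mod n) else B $$ ((i - n\<^sup>2) div n, (i - n\<^sup>2) mod n))"
    if "i < 2 * n\<^sup>2" for A B :: "'a mat" and i
    using that by (simp add: mat_pair_coords_def)
  have dim: "dim_vec (mat_pair_coords n (A, B)) = 2 * n\<^sup>2" for A B :: "'a mat"
    by (simp add: mat_pair_coords_def)
  show ?thesis
  proof (rule bij_betw_byWitness[where f' = g])
    show "\<forall>a\<in>carrier_mat n n \<times> carrier_mat n n. g (mat_pair_coords n a) = a"
    proof
      fix a :: "'a mat \<times> 'a mat"
      assume "a \<in> carrier_mat n n \<times> carrier_mat n n"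
      then obtain A B where a: "a = (A, B)" "A \<in> carrier_mat n n" "B \<in> carrier_mat n n"
        by auto
      have "mat n n (\<lambda>(i, j). mat_pair_coords n (A, B) $ (i * n + j)) = A"
      proof (rule eq_matI)
        fix i j assume "i < dim_row A" "j < dim_col A"
        with a have ij: "i < n" "j < n" by auto
        with lt[OF ij] show "mat n n (\<lambda>(i, j). mat_pair_coords n (A, B) $ (i * n + j)) $$ (i, j) = A $$ (i, j)"
          by (simp add: idx)
      qed (use a in auto)
      moreover have "mat n n (\<lambda>(i, j). mat_pair_coords n (A, B) $ (n\<^sup>2 + (i * n + j))) = B"
      proof (rule eq_matI)
        fix i j assume "i < dim_row B" "j < dim_col B"
        with a have ij: "i < n" "j < n" by auto
        with lt[OF ij] show "mat n n (\<lambda>(i, j). mat_pair_coords n (A, B) $ (n\<^sup>2 + (i * n + j))) $$ (i, j) = B $$ (i, j)"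
          by (simp add: idx)
      qed (use a in auto)
      ultimately show "g (mat_pair_coords n a) = a"
        by (simp add: g_def a)
    qed
    show "\<forall>v\<in>carrier_vec (2 * n\<^sup>2). mat_pair_coords n (g v) = v"
    proof
      fix v :: "'a vec" assume v: "v \<in> carrier_vec (2 * n\<^sup>2)"
      show "mat_pair_coords n (g v) = v"
      proof (rule eq_vecI)
        fix i assume "i < dim_vec v"
        with v have i: "i < 2 * n\<^sup>2" by simp
        show "mat_pair_coords n (g v) $ i = v $ i"
        proof (cases "i < n\<^sup>2")
          case True
          then show ?thesis using i dm[of i] by (simp add: g_def idx)
        next
          case False
          with i have "i - n\<^sup>2 < n\<^sup>2" by simp
          with False i dm[of "i - n\<^sup>2"] show ?thesis by (simp add: g_def idx)
        qed
      qed (use v in \<open>simp add: g_def dim\<close>)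
    qed
    show "mat_pair_coords n ` (carrier_mat n n \<times> carrier_mat n n) \<subseteq> (carrier_vec (2 * n\<^sup>2) :: 'a vec set)"
      using dim by (auto intro!: carrier_vecI)
    show "g ` carrier_vec (2 * n\<^sup>2) \<subseteq> carrier_mat n n \<times> carrier_mat n n"
      by (auto simp: g_def)
  qed
qed

end

theory Submission
  imports Defs "Jordan_Normal_Form.Determinant"
begin

text \<open>
  For \<open>d \<ge> 1\<close> the distance of \<open>A\<close> and \<open>B\<close> is at most \<open>d\<close> iff there are nonscalar
  \<open>C\<^sub>1, \<dots>, C\<^sub>d\<^sub>-\<^sub>1\<close> such that consecutive members of \<open>A, C\<^sub>1, \<dots>, C\<^sub>d\<^sub>-\<^sub>1, B\<close> commute; repetitions
  are harmless, and scalar or equal \<open>A\<close>, \<open>B\<close> always admit such a chain. Commuting with a matrix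
  is invariant under \<open>C \<mapsto> l C + m I\<close>, so a nonscalar \<open>C\<close> is a point of the projective space of
  matrices modulo scalars. For \<open>d = 2\<close> the condition on the single \<open>C\<close> is linear and its
  solvability is the vanishing of minors, over every field. In general the \<open>C\<^sub>i\<close> are removed one
  after the other by elimination theory: over an algebraically closed field the projection along
  a projective space of a closed set is closed. Splitting off one coordinate at a time reduces
  this to the projective line, where forms of degree \<open>D\<close> have a common zero iff their multiples do
  not span the forms of degree \<open>2 * D - 1\<close>, which is again a vanishing of minors.
\<close>

section \<open>Polynomial functions and closed sets\<close>

text \<open>Polynomial functions stand in for formal polynomials. The index type is arbitrary, so
  blocks of variables can be kept apart by sum types, and closure properties follow by rule
  induction.\<close>

inductive polyfun :: "(('i \<Rightarrow> 'a::comm_ring_1) \<Rightarrow> 'a) \<Rightarrow> bool" where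
  polyfun_const: "polyfun (\<lambda>x. c)"
| polyfun_var: "polyfun (\<lambda>x. x i)"
| polyfun_add: "polyfun f \<Longrightarrow> polyfun g \<Longrightarrow> polyfun (\<lambda>x. f x + g x)"
| polyfun_mult: "polyfun f \<Longrightarrow> polyfun g \<Longrightarrow> polyfun (\<lambda>x. f x * g x)"

lemma polyfun_diff:
  assumes "polyfun f" "polyfun g"
  shows "polyfun (\<lambda>x. f x - g x)"
  using polyfun_add[OF assms(1) polyfun_mult[OF polyfun_const[of "-1"] assms(2)]] by simp

lemma polyfun_sum:
  assumes "\<And>k. k \<in> K \<Longrightarrow> polyfun (f k)"
  shows "polyfun (\<lambda>x. \<Sum>k\<in>K. f k x)"
  using assms
  by (induction K rule: infinite_finite_induct) (auto intro: polyfun_const polyfun_add)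

lemma polyfun_prod:
  assumes "\<And>k. k \<in> K \<Longrightarrow> polyfun (f k)"
  shows "polyfun (\<lambda>x. \<Prod>k\<in>K. f k x)"
  using assms
  by (induction K rule: infinite_finite_induct) (auto intro: polyfun_const polyfun_mult)

lemma polyfun_if:
  assumes "b \<Longrightarrow> polyfun f" "\<not> b \<Longrightarrow> polyfun g"
  shows "polyfun (\<lambda>x. if b then f x else g x)"
  using assms by (cases b) auto

lemma polyfun_subst:
  assumes "polyfun f" "\<And>j. polyfun (\<phi> j)"
  shows "polyfun (\<lambda>x. f (\<lambda>j. \<phi> j x))"
  using assms(1)
proof induction
  case (polyfun_var i)
  show ?case by (rule assms(2))
qed (auto intro: polyfun.intros)

lemma permutes_lt: "p permutes {0..<m} \<Longrightarrow> i < m \<Longrightarrow> p i < m" for m :: nat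
  using permutes_in_image[of p "{0..<m}" i] by simp

lemma polyfun_det:
  assumes "\<And>i j. i < m \<Longrightarrow> j < m \<Longrightarrow> polyfun (f i j)"
  shows "polyfun (\<lambda>x. det (mat m m (\<lambda>(i, j). f i j x)))"
proof -
  have "det (mat m m (\<lambda>(i, j). f i j x)) =
    (\<Sum>p\<in>{p. p permutes {0..<m}}. signof p * (\<Prod>i = 0..<m. f i (p i) x))" for x
    by (subst det_def'[of _ m]) (auto intro!: sum.cong prod.cong dest: permutes_lt)
  moreover have "polyfun (\<lambda>x. \<Sum>p\<in>{p. p permutes {0..<m}}. signof p * (\<Prod>i = 0..<m. f i (p i) x))"
    by (intro polyfun_sum polyfun_mult polyfun_const polyfun_prod assms) (auto dest: permutes_lt)
  ultimately show ?thesis by simp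
qed

text \<open>Closed sets are predicates on assignments of values to the variables, so that
  elimination is literally an existential quantifier.\<close>

definition zariski_closed :: "(('i \<Rightarrow> 'a::comm_ring_1) \<Rightarrow> bool) \<Rightarrow> bool" where
  "zariski_closed P \<longleftrightarrow>
     (\<exists>F. finite F \<and> (\<forall>f\<in>F. polyfun f) \<and> (\<forall>x. P x \<longleftrightarrow> (\<forall>f\<in>F. f x = 0)))"

lemma zariski_closed_zero: "polyfun f \<Longrightarrow> zariski_closed (\<lambda>x. f x = 0)"
  unfolding zariski_closed_def by (intro exI[of _ "{f}"]) auto

lemma zariski_closed_eq:
  "polyfun f \<Longrightarrow> polyfun g \<Longrightarrow> zariski_closed (\<lambda>x. f x = g x)"
  using zariski_closed_zero[OF polyfun_diff, of f g] by simp

lemma zariski_closed_False: "zariski_closed (\<lambda>x. False)"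
  using zariski_closed_zero[OF polyfun_const[of 1]] by simp

lemma zariski_closed_ball:
  assumes "finite K" "\<And>k. k \<in> K \<Longrightarrow> zariski_closed (P k)"
  shows "zariski_closed (\<lambda>x. \<forall>k\<in>K. P k x)"
proof -
  have "\<forall>k\<in>K. \<exists>F. finite F \<and> (\<forall>f\<in>F. polyfun f) \<and> (\<forall>x. P k x \<longleftrightarrow> (\<forall>f\<in>F. f x = 0))"
    using assms(2) by (simp add: zariski_closed_def)
  then obtain F where F: "\<And>k. k \<in> K \<Longrightarrow> finite (F k)"
    "\<And>k. k \<in> K \<Longrightarrow> (\<forall>f\<in>F k. polyfun f)"
    "\<And>k x. k \<in> K \<Longrightarrow> P k x \<longleftrightarrow> (\<forall>f\<in>F k. f x = 0)"
    by metis
  show ?thesis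
    unfolding zariski_closed_def
    by (intro exI[of _ "\<Union>k\<in>K. F k"]) (use F assms(1) in auto)
qed

lemma zariski_closed_conj:
  assumes "zariski_closed P" "zariski_closed Q"
  shows "zariski_closed (\<lambda>x. P x \<and> Q x)"
proof -
  have "zariski_closed (\<lambda>x. \<forall>b\<in>UNIV. (if b then P else Q) x)"
    by (rule zariski_closed_ball) (use assms in auto)
  moreover have "(\<forall>b\<in>UNIV. (if b then P else Q) x) \<longleftrightarrow> P x \<and> Q x" for x
    by (metis UNIV_I)
  ultimately show ?thesis by simp
qed

lemma zariski_closed_subst:
  assumes "zariski_closed P" "\<And>j. polyfun (\<phi> j)"
  shows "zariski_closed (\<lambda>x. P (\<lambda>j. \<phi> j x))"
proof -
  obtain F where F: "finite F" "\<forall>f\<in>F. polyfun f" "\<forall>x. P x \<longleftrightarrow> (\<forall>f\<in>F. f x = 0)"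
    using assms(1) by (auto simp: zariski_closed_def)
  have "\<forall>g\<in>(\<lambda>f x. f (\<lambda>j. \<phi> j x)) ` F. polyfun g"
    using F(2) by (auto intro!: polyfun_subst[OF _ assms(2)])
  then show ?thesis
    unfolding zariski_closed_def
    by (intro exI[of _ "(\<lambda>f x. f (\<lambda>j. \<phi> j x)) ` F"]) (simp add: F(1,3))
qed

section \<open>Passage to formal polynomials in finitely many variables\<close>

definition mpoly_fun :: "nat \<Rightarrow> ((nat \<Rightarrow> 'a::comm_ring_1) \<Rightarrow> 'a) \<Rightarrow> bool" where
  "mpoly_fun N f \<longleftrightarrow> (\<exists>p. mpoly_vars p \<subseteq> {..<N} \<and> f = (\<lambda>x. mpoly_eval x p))"

lemma mpoly_fun_add:
  assumes "mpoly_fun N f" "mpoly_fun N g"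
  shows "mpoly_fun N (\<lambda>x. f x + g x)"
proof -
  obtain p q where p: "mpoly_vars p \<subseteq> {..<N}" "f = (\<lambda>x. mpoly_eval x p)"
    and q: "mpoly_vars q \<subseteq> {..<N}" "g = (\<lambda>x. mpoly_eval x q)"
    using assms by (auto simp: mpoly_fun_def)
  have "mpoly_vars (p + q) \<subseteq> {..<N}"
    using p q keys_add[of p q] unfolding mpoly_vars_def by blast
  moreover have "mpoly_eval x (p + q) = f x + g x" for x
    unfolding p q mpoly_eval_def by (rule setsum_keys_plus_distrib) (auto simp: algebra_simps)
  ultimately show ?thesis
    unfolding mpoly_fun_def by metis
qed

lemma mpoly_fun_monom:
  assumes "Poly_Mapping.keys m \<subseteq> {..<N}"
  shows "mpoly_fun N (\<lambda>x. c * (\<Prod>i\<in>Poly_Mapping.keys m. x i ^ Poly_Mapping.lookup m i))"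
  unfolding mpoly_fun_def
  by (rule exI[of _ "Poly_Mapping.single m c"])
     (use assms in \<open>auto simp: mpoly_vars_def mpoly_eval_def split: if_splits\<close>)

lemma mpoly_fun_const: "mpoly_fun N (\<lambda>x. c)"
  using mpoly_fun_monom[of 0 N c] by simp

lemma mpoly_fun_var: "i < N \<Longrightarrow> mpoly_fun N (\<lambda>x. x i)"
  using mpoly_fun_monom[of "Poly_Mapping.single i 1" N 1] by simp

lemma mpoly_fun_sum:
  assumes "\<And>k. k \<in> K \<Longrightarrow> mpoly_fun N (f k)"
  shows "mpoly_fun N (\<lambda>x. \<Sum>k\<in>K. f k x)"
  using assms
  by (induction K rule: infinite_finite_induct) (auto intro: mpoly_fun_const mpoly_fun_add)

text \<open>All three products can be taken over the union of the two sets of keys, since an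
  exponent outside the keys is zero and contributes the factor 1.\<close>

lemma monom_value_add:
  fixes x :: "nat \<Rightarrow> 'a::comm_ring_1"
  shows "(\<Prod>i\<in>Poly_Mapping.keys (m + m'). x i ^ Poly_Mapping.lookup (m + m') i) =
    (\<Prod>i\<in>Poly_Mapping.keys m. x i ^ Poly_Mapping.lookup m i) *
    (\<Prod>i\<in>Poly_Mapping.keys m'. x i ^ Poly_Mapping.lookup m' i)"
proof -
  let ?K = "Poly_Mapping.keys m \<union> Poly_Mapping.keys m'"
  have *: "(\<Prod>i\<in>Poly_Mapping.keys l. x i ^ Poly_Mapping.lookup l i) =
      (\<Prod>i\<in>?K. x i ^ Poly_Mapping.lookup l i)" if "Poly_Mapping.keys l \<subseteq> ?K" for l
    using that by (intro prod.mono_neutral_left) (auto simp: in_keys_iff)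
  show ?thesis
    unfolding *[OF keys_add] *[OF Un_upper1] *[OF Un_upper2]
    by (simp add: lookup_add power_add prod.distrib)
qed

text \<open>The double sum of products of terms is again a sum of monomial functions. This avoids
  the formal product \<open>p * q\<close>, whose terms may merge or cancel.\<close>

lemma mpoly_fun_mult:
  assumes "mpoly_fun N f" "mpoly_fun N g"
  shows "mpoly_fun N (\<lambda>x. f x * g x)"
proof -
  obtain p q where p: "mpoly_vars p \<subseteq> {..<N}" "f = (\<lambda>x. mpoly_eval x p)"
    and q: "mpoly_vars q \<subseteq> {..<N}" "g = (\<lambda>x. mpoly_eval x q)"
    using assms by (auto simp: mpoly_fun_def)
  have "f x * g x = (\<Sum>m\<in>Poly_Mapping.keys p. \<Sum>m'\<in>Poly_Mapping.keys q.
      (Poly_Mapping.lookup p m * Poly_Mapping.lookup q m') *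
      (\<Prod>i\<in>Poly_Mapping.keys (m + m'). x i ^ Poly_Mapping.lookup (m + m') i))" for x
    unfolding p q mpoly_eval_def sum_product monom_value_add by (simp add: mult_ac)
  moreover have "Poly_Mapping.keys (m + m') \<subseteq> {..<N}"
    if "m \<in> Poly_Mapping.keys p" "m' \<in> Poly_Mapping.keys q" for m m'
    using that p q keys_add[of m m'] unfolding mpoly_vars_def by blast
  ultimately show ?thesis
    by (auto intro!: mpoly_fun_sum mpoly_fun_monom)
qed

lemma mpoly_fun_polyfun:
  assumes "polyfun f" "\<And>j. mpoly_fun N (\<phi> j)"
  shows "mpoly_fun N (\<lambda>x. f (\<lambda>j. \<phi> j x))"
  using assms(1)
proof induction
  case (polyfun_var i)
  show ?case by (rule assms(2))
qed (auto intro: mpoly_fun_const mpoly_fun_add mpoly_fun_mult)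

text \<open>The maps \<open>\<phi> j\<close> give the value of the abstract variable
  \<open>j\<close> as a polynomial in the coordinates of the vector. Substituting them turns each
  equation into a formal polynomial in \<open>N\<close> variables.\<close>

lemma affine_variety_zariski_closed:
  fixes P :: "('i \<Rightarrow> 'a::field) \<Rightarrow> bool"
  assumes "zariski_closed P" "\<And>j. mpoly_fun N (\<phi> j)"
  shows "affine_variety N {v \<in> carrier_vec N. P (\<lambda>j. \<phi> j (\<lambda>i. v $ i))}"
proof -
  obtain F where F: "finite F" "\<forall>f\<in>F. polyfun f" "\<forall>x. P x \<longleftrightarrow> (\<forall>f\<in>F. f x = 0)"
    using assms(1) by (auto simp: zariski_closed_def)
  have "\<forall>f\<in>F. \<exists>p. mpoly_vars p \<subseteq> {..<N} \<and> (\<lambda>x. f (\<lambda>j. \<phi> j x)) = (\<lambda>x. mpoly_eval x p)"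
  proof
    fix f assume "f \<in> F"
    with F(2) have "polyfun f" by simp
    from mpoly_fun_polyfun[of f N \<phi>, OF this assms(2)] show "\<exists>p. mpoly_vars p \<subseteq> {..<N} \<and> (\<lambda>x. f (\<lambda>j. \<phi> j x)) = (\<lambda>x. mpoly_eval x p)"
      by (simp add: mpoly_fun_def)
  qed
  then obtain p where p: "\<And>f. f \<in> F \<Longrightarrow> mpoly_vars (p f) \<subseteq> {..<N}"
    "\<And>f. f \<in> F \<Longrightarrow> (\<lambda>x. f (\<lambda>j. \<phi> j x)) = (\<lambda>x. mpoly_eval x (p f))"
    by metis
  have "f (\<lambda>j. \<phi> j x) = mpoly_eval x (p f)" if "f \<in> F" for f x
    using p(2)[OF that] by meson
  then show ?thesis
    unfolding affine_variety_def
    by (intro exI[of _ "p ` F"]) (use F(1,3) p(1) in auto)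
qed

section \<open>Linear elimination\<close>

text \<open>Induction on the number of columns: some vector \<open>w\<close> with last entry \<open>-1\<close> is
  killed by the rows chosen so far; a row that does not kill \<open>w\<close> is the one to append.\<close>

lemma full_rank_minor:
  fixes M :: "'r \<Rightarrow> nat \<Rightarrow> 'a::field"
  assumes "\<And>v. \<forall>r\<in>R. (\<Sum>j<m. M r j * v j) = 0 \<Longrightarrow> \<forall>j<m. v j = 0"
  shows "\<exists>\<rho>. \<rho> ` {..<m} \<subseteq> R \<and> det (mat m m (\<lambda>(i, j). M (\<rho> i) j)) \<noteq> 0"
  using assms
proof (induction m)
  case 0
  show ?case by (auto simp: det_def)
next
  case (Suc m)
  \<comment> \<open>The first \<open>m\<close> columns inherit the hypothesis: a kernel vector is
    extended by a last entry 0.\<close>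
  have "\<forall>j<m. v j = 0" if "\<forall>r\<in>R. (\<Sum>j<m. M r j * v j) = 0" for v
  proof -
    have "\<forall>j<Suc m. (v(m := 0)) j = 0"
      by (rule Suc.prems) (use that in simp)
    then show ?thesis by (metis fun_upd_other less_Suc_eq nat_neq_iff)
  qed
  from Suc.IH[OF this] obtain \<rho> where \<rho>: "\<rho> ` {..<m} \<subseteq> R"
    and det: "det (mat m m (\<lambda>(i, j). M (\<rho> i) j)) \<noteq> 0" by blast
  define N where "N = mat m m (\<lambda>(i, j). M (\<rho> i) j)"
  have N: "N \<in> carrier_mat m m" by (simp add: N_def)
  from det_non_zero_imp_unit[OF N, of "()"] det obtain B where B: "B \<in> carrier_mat m m" "N * B = 1\<^sub>m m"
    unfolding Units_def ring_mat_def N_def by auto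
  \<comment> \<open>On the chosen rows, \<open>u\<close> expresses the last column through the first
    \<open>m\<close> columns; \<open>w\<close> below is the resulting relation
    \<open>(u, -1)\<close>.\<close>
  define c where "c = vec m (\<lambda>i. M (\<rho> i) m)"
  define u where "u = B *\<^sub>v c"
  have u: "u \<in> carrier_vec m" using B by (simp add: u_def c_def)
  have "N *\<^sub>v u = c"
    unfolding u_def using B N by (subst assoc_mult_mat_vec[symmetric, of _ m m _ m]) (auto simp: c_def)
  then have Nu_c: "(N *\<^sub>v u) $ i = c $ i" for i by simp
  have Nu: "(\<Sum>j<m. M (\<rho> i) j * u $ j) = M (\<rho> i) m" if "i < m" for i
    using Nu_c[of i] that u by (simp add: N_def c_def scalar_prod_def atLeast0LessThan)
  define w where "w j = (if j < m then u $ j else - 1)" for j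
  have "\<not> (\<forall>j<Suc m. w j = 0)" by (auto simp: w_def)
  then obtain r where r: "r \<in> R" "(\<Sum>j<Suc m. M r j * w j) \<noteq> 0"
    using Suc.prems[of w] by blast
  define \<sigma> where "\<sigma> = \<rho>(m := r)"
  let ?S = "mat (Suc m) (Suc m) (\<lambda>(i, j). M (\<sigma> i) j)"
  have "det ?S \<noteq> 0"
  proof
    assume "det ?S = 0"
    then obtain v where v: "v \<in> carrier_vec (Suc m)" "v \<noteq> 0\<^sub>v (Suc m)" "?S *\<^sub>v v = 0\<^sub>v (Suc m)"
      using det_0_iff_vec_prod_zero_field[of ?S "Suc m"] by auto
    have row: "(\<Sum>j<Suc m. M (\<sigma> i) j * v $ j) = 0" if "i < Suc m" for i
      using that v(1) arg_cong[OF v(3), of "\<lambda>v. v $ i"]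
      by (simp add: scalar_prod_def atLeast0LessThan)
    \<comment> \<open>These are the first \<open>m\<close> entries of \<open>v + v $ m * w\<close>,
      whose last entry is 0. The chosen rows kill both \<open>v\<close> and \<open>w\<close>, so
      invertibility of \<open>N\<close> forces \<open>v = - (v $ m) * w\<close>, and the row
      \<open>r\<close> then forces \<open>v $ m = 0\<close>.\<close>
    define v' where "v' = vec m (\<lambda>j. v $ j + v $ m * u $ j)"
    have "N *\<^sub>v v' = 0\<^sub>v m"
    proof (rule eq_vecI)
      fix i assume i: "i < dim_vec (0\<^sub>v m :: 'a vec)"
      then have "(\<Sum>j<m. M (\<rho> i) j * v $ j) + v $ m * (\<Sum>j<m. M (\<rho> i) j * u $ j) = 0"
        using row[of i] Nu[of i] by (simp add: \<sigma>_def mult.commute)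
      then show "(N *\<^sub>v v') $ i = 0\<^sub>v m $ i"
        using i by (simp add: N_def v'_def scalar_prod_def atLeast0LessThan algebra_simps
            sum.distrib sum_distrib_left)
    qed (simp add: N_def)
    then have "v' = 0\<^sub>v m"
      using det det_0_iff_vec_prod_zero_field[OF N] unfolding N_def v'_def by (metis vec_carrier)
    then have "\<forall>j<m. v $ j + v $ m * u $ j = 0"
      by (metis index_vec index_zero_vec(1) v'_def)
    then have vw: "v $ j = - (v $ m) * w j" if "j < Suc m" for j
      using that by (auto simp: w_def less_Suc_eq eq_neg_iff_add_eq_0)
    have "0 = (\<Sum>j<Suc m. M r j * v $ j)"
      using row[of m] by (simp add: \<sigma>_def)
    also have "\<dots> = - (v $ m) * (\<Sum>j<Suc m. M r j * w j)"
      unfolding sum_distrib_left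
      by (rule sum.cong) (use vw in \<open>metis lessThan_iff mult.left_commute\<close>)+
    finally have "v $ m = 0" using r(2) by auto
    then have "v $ j = 0" if "j < Suc m" for j
      using vw[OF that] by simp
    then have "v = 0\<^sub>v (Suc m)"
      using v(1) by (intro eq_vecI) auto
    with v(2) show False by simp
  qed
  moreover have "\<sigma> ` {..<Suc m} \<subseteq> R" using \<rho> r(1) by (auto simp: \<sigma>_def)
  ultimately show ?case by blast
qed

text \<open>A linear system has a nonzero solution iff all maximal minors of its matrix vanish. The
  functions \<open>\<rho>\<close> choose \<open>m\<close> rows from \<open>R\<close>; a choice with
  repeated rows has determinant 0, so systems with fewer than \<open>m\<close> rows are covered as
  well.\<close>

lemma zariski_closed_kernel:
  fixes M :: "'r \<Rightarrow> nat \<Rightarrow> ('i \<Rightarrow> 'a::field) \<Rightarrow> 'a"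
  assumes "finite R" "\<And>r j. r \<in> R \<Longrightarrow> j < m \<Longrightarrow> polyfun (M r j)"
  shows "zariski_closed (\<lambda>x. \<exists>v. (\<exists>j<m. v j \<noteq> 0) \<and> (\<forall>r\<in>R. (\<Sum>j<m. M r j x * v j) = 0))"
proof -
  let ?K = "{..<m} \<rightarrow>\<^sub>E R"
  let ?D = "\<lambda>\<rho> x. det (mat m m (\<lambda>(i, j). M (\<rho> i) j x))"
  have "(\<exists>v. (\<exists>j<m. v j \<noteq> 0) \<and> (\<forall>r\<in>R. (\<Sum>j<m. M r j x * v j) = 0)) \<longleftrightarrow>
      (\<forall>\<rho>\<in>?K. ?D \<rho> x = 0)" (is "?L \<longleftrightarrow> ?Q") for x
  proof
    assume ?L
    then obtain v where v: "\<exists>j<m. v j \<noteq> 0" "\<forall>r\<in>R. (\<Sum>j<m. M r j x * v j) = 0" by blast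
    show ?Q
    proof
      fix \<rho> assume \<rho>: "\<rho> \<in> ?K"
      have "vec m v \<noteq> 0\<^sub>v m" using v(1) by (metis index_vec index_zero_vec(1))
      moreover have "mat m m (\<lambda>(i, j). M (\<rho> i) j x) *\<^sub>v vec m v = 0\<^sub>v m"
        using v(2) \<rho> by (intro eq_vecI) (auto simp: scalar_prod_def atLeast0LessThan PiE_iff)
      ultimately show "?D \<rho> x = 0"
        using det_0_iff_vec_prod_zero_field[of "mat m m (\<lambda>(i, j). M (\<rho> i) j x)" m]
        by (metis mat_carrier vec_carrier)
    qed
  next
    assume Q: ?Q
    show ?L
    proof (rule ccontr)
      assume "\<not> ?L"
      then have "\<exists>\<rho>. \<rho> ` {..<m} \<subseteq> R \<and> ?D \<rho> x \<noteq> 0"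
        by (intro full_rank_minor) auto
      then obtain \<rho> where \<rho>: "\<rho> ` {..<m} \<subseteq> R" "?D \<rho> x \<noteq> 0" by blast
      \<comment> \<open>Members of the finite index set \<open>?K\<close> must be
        \<open>undefined\<close> outside \<open>{..<m}\<close>.\<close>
      have "restrict \<rho> {..<m} \<in> ?K" using \<rho>(1) by auto
      moreover have "mat m m (\<lambda>(i, j). M (restrict \<rho> {..<m} i) j x) = mat m m (\<lambda>(i, j). M (\<rho> i) j x)"
        by (rule cong_mat) auto
      ultimately show False using Q \<rho>(2) by metis
    qed
  qed
  moreover have "zariski_closed (\<lambda>x. \<forall>\<rho>\<in>?K. ?D \<rho> x = 0)"
    using assms
    by (intro zariski_closed_ball zariski_closed_zero polyfun_det) (auto intro: finite_PiE)
  ultimately show ?thesis by simp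
qed

lemma zariski_closed_kernel_set:
  fixes M :: "'r \<Rightarrow> 'c \<Rightarrow> ('i \<Rightarrow> 'a::field) \<Rightarrow> 'a"
  assumes "finite R" "finite J" "\<And>r j. r \<in> R \<Longrightarrow> j \<in> J \<Longrightarrow> polyfun (M r j)"
  shows "zariski_closed (\<lambda>x. \<exists>v. (\<exists>j\<in>J. v j \<noteq> 0) \<and> (\<forall>r\<in>R. (\<Sum>j\<in>J. M r j x * v j) = 0))"
proof -
  obtain e where e: "bij_betw e {..<card J} J"
    using ex_bij_betw_nat_finite[OF assms(2)] by (auto simp: atLeast0LessThan)
  have sum_e: "(\<Sum>j\<in>J. f j) = (\<Sum>i<card J. f (e i))" for f :: "'c \<Rightarrow> 'a"
    by (rule sum.reindex_bij_betw[OF e, symmetric])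
  have "(\<exists>v. (\<exists>j\<in>J. v j \<noteq> 0) \<and> (\<forall>r\<in>R. (\<Sum>j\<in>J. M r j x * v j) = 0)) \<longleftrightarrow>
      (\<exists>v. (\<exists>i<card J. v i \<noteq> 0) \<and> (\<forall>r\<in>R. (\<Sum>i<card J. M r (e i) x * v i) = 0))" (is "?L \<longleftrightarrow> ?R") for x
  proof
    assume ?L
    then obtain v where v: "\<exists>j\<in>J. v j \<noteq> 0" "\<forall>r\<in>R. (\<Sum>j\<in>J. M r j x * v j) = 0" by blast
    have "\<exists>i<card J. v (e i) \<noteq> 0"
      using v(1) e unfolding bij_betw_def by (metis imageE lessThan_iff)
    then show ?R using v(2) by (intro exI[of _ "\<lambda>i. v (e i)"]) (simp add: sum_e)
  next
    assume ?R
    then obtain v where v: "\<exists>i<card J. v i \<noteq> 0" "\<forall>r\<in>R. (\<Sum>i<card J. M r (e i) x * v i) = 0" by blast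
    let ?e = "the_inv_into {..<card J} e"
    have inv: "?e (e i) = i" if "i < card J" for i
      using that e by (intro the_inv_into_f_f) (auto simp: bij_betw_def)
    have "\<exists>j\<in>J. v (?e j) \<noteq> 0"
      using v(1) inv e by (metis bij_betwE lessThan_iff)
    then show ?L using v(2) by (intro exI[of _ "\<lambda>j. v (?e j)"]) (simp add: sum_e inv)
  qed
  moreover have "zariski_closed (\<lambda>x. \<exists>v. (\<exists>i<card J. v i \<noteq> 0) \<and> (\<forall>r\<in>R. (\<Sum>i<card J. M r (e i) x * v i) = 0))"
    by (rule zariski_closed_kernel[OF assms(1)]) (use assms(3) e in \<open>auto simp: bij_betw_def\<close>)
  ultimately show ?thesis by simp
qed

section \<open>Elimination over algebraically closed fields\<close>

text \<open>Euclid's argument: over a finite field the product of all \<open>X - a\<close>, plus 1,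
  has positive degree and no root.\<close>

lemma infinite_UNIV_alg_closed: "infinite (UNIV :: 'a::alg_closed_field set)"
proof
  assume fin: "finite (UNIV :: 'a set)"
  let ?p = "(\<Prod>a\<in>UNIV. [:-a, 1:]) + 1 :: 'a poly"
  have "degree (\<Prod>a\<in>UNIV. [:-a, 1:] :: 'a poly) = card (UNIV :: 'a set)"
    by (subst degree_prod_eq_sum_degree) auto
  moreover have "card (UNIV :: 'a set) > 0"
    using fin by (simp add: card_gt_0_iff)
  ultimately have "degree ?p > 0"
    by (subst degree_add_eq_left) auto
  then obtain x where "poly ?p x = 0"
    using alg_closed_imp_poly_has_root by blast
  moreover have "poly (\<Prod>a\<in>UNIV. [:-a, 1:]) x = 0"
    using fin by (auto simp: poly_prod prod_zero_iff)
  ultimately show False by simp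
qed

text \<open>A nonzero element of least degree generates, because the remainder of any
  \<open>p\<close> in \<open>J\<close> modulo it lies in \<open>J\<close> and is zero or of smaller
  degree.\<close>

lemma poly_ideal_generator:
  fixes J :: "'a::field poly set"
  assumes mult: "\<And>g h. g \<in> J \<Longrightarrow> g * h \<in> J" and diff: "\<And>g h. g \<in> J \<Longrightarrow> h \<in> J \<Longrightarrow> g - h \<in> J"
    and "F \<in> J" "F \<noteq> 0"
  obtains g where "g \<in> J" "g \<noteq> 0" "\<And>p. p \<in> J \<Longrightarrow> g dvd p"
proof -
  obtain g where g: "g \<in> J" "g \<noteq> 0" "\<And>h. h \<in> J \<Longrightarrow> h \<noteq> 0 \<Longrightarrow> degree g \<le> degree h"
    using ex_has_least_nat[of "\<lambda>g. g \<in> J \<and> g \<noteq> 0" F degree] assms(3,4) by blast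
  have "g dvd p" if "p \<in> J" for p
  proof (rule ccontr)
    assume "\<not> g dvd p"
    then have "p mod g \<noteq> 0" by (simp add: mod_eq_0_iff_dvd)
    moreover have "p mod g \<in> J"
      using diff[OF that mult[OF g(1), of "p div g"]] by (simp add: minus_mult_div_eq_mod)
    ultimately show False
      using g(3)[of "p mod g"] degree_mod_less'[OF g(2), of p] by auto
  qed
  with g show ?thesis using that by blast
qed

text \<open>The forms of degree \<open>D\<close> with dehomogenisations \<open>p q\<close> have no common zero on the
  projective line iff their multiples span all forms of degree \<open>2 * D - 1\<close>; the left-hand side
  provides a nonzero functional \<open>\<phi>\<close> killing these multiples. The second disjunct on the right
  is a common zero at infinity.\<close>

lemma common_zero_iff_functional:
  fixes p :: "'q \<Rightarrow> 'a::alg_closed_field poly"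
  assumes deg: "\<And>q. q \<in> Q \<Longrightarrow> degree (p q) \<le> D" and D: "D > 0"
  shows "(\<exists>\<phi>. (\<exists>j<2 * D. \<phi> j \<noteq> 0) \<and>
            (\<forall>(q, a)\<in>Q \<times> {..<D}. (\<Sum>j<2 * D. coeff (monom 1 a * p q) j * \<phi> j) = 0)) \<longleftrightarrow>
         (\<exists>x. \<forall>q\<in>Q. poly (p q) x = 0) \<or> (\<forall>q\<in>Q. coeff (p q) D = 0)"
    (is "?L \<longleftrightarrow> ?A \<or> ?B")
proof
  assume "?A \<or> ?B"
  then show ?L
  proof
    assume ?A
    then obtain x where x: "\<And>q. q \<in> Q \<Longrightarrow> poly (p q) x = 0" by blast
    \<comment> \<open>Evaluation at a common zero, \<open>\<phi> j = x ^ j\<close>, kills all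
      multiples; the degree bound ensures that the sum below \<open>2 * D\<close> sees the whole
      polynomial.\<close>
    have "(\<Sum>j<2 * D. coeff (monom 1 a * p q) j * x ^ j) = 0" if "q \<in> Q" "a < D" for q a
    proof -
      have "degree (monom 1 a * p q) \<le> a + degree (p q)"
        using degree_mult_le[of "monom 1 a" "p q"] degree_monom_le[of "1::'a" a] by linarith
      then have "degree (monom 1 a * p q) < 2 * D"
        using deg[OF that(1)] that(2) by linarith
      then have "(\<Sum>j<2 * D. coeff (monom 1 a * p q) j * x ^ j) = poly (monom 1 a * p q) x"
        unfolding poly_altdef by (intro sum.mono_neutral_right) (auto simp: coeff_eq_0)
      then show ?thesis by (simp add: x that)
    qed
    then show ?L
      using D by (intro exI[of _ "\<lambda>j. x ^ j"] conjI exI[of _ 0]) auto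
  next
    assume B: ?B
    \<comment> \<open>The functional reads off the coefficient at \<open>2 * D - 1\<close>. A
      multiple by \<open>X ^ a\<close> with \<open>a < D\<close> contributes a coefficient of
      \<open>p q\<close> at an index at least \<open>D\<close>, and this index is \<open>D\<close>
      only for \<open>a = D - 1\<close>.\<close>
    have "(\<Sum>j<2 * D. coeff (monom 1 a * p q) j * (if j = 2 * D - 1 then 1 else 0)) = 0"
      if "q \<in> Q" "a < D" for q a
    proof -
      have "(\<Sum>j<2 * D. coeff (monom 1 a * p q) j * (if j = 2 * D - 1 then 1 else 0)) =
          coeff (p q) (2 * D - 1 - a)"
        using that D
        by (subst sum.mono_neutral_right[of _ "{2 * D - 1}"]) (auto simp: coeff_monom_mult)
      also have "\<dots> = 0"
      proof (cases "a = D - 1")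
        case True
        then have "2 * D - 1 - a = D" using D by simp
        then show ?thesis using B that by simp
      next
        case False
        then show ?thesis using deg[OF that(1)] that by (intro coeff_eq_0) linarith
      qed
      finally show ?thesis .
    qed
    then show ?L
      using D by (intro exI[of _ "\<lambda>j. if j = 2 * D - 1 then 1 else 0"] conjI exI[of _ "2 * D - 1"]) auto
  qed
next
  assume ?L
  then obtain \<phi> where nz: "\<exists>j<2 * D. \<phi> j \<noteq> 0"
    and kill: "\<And>q a. q \<in> Q \<Longrightarrow> a < D \<Longrightarrow> (\<Sum>j<2 * D. coeff (monom 1 a * p q) j * \<phi> j) = 0"
    by auto
  show "?A \<or> ?B"
  proof (cases ?B)
    case False
    then obtain q0 where q0: "q0 \<in> Q" "coeff (p q0) D \<noteq> 0" by blast
    \<comment> \<open>Without a common zero at infinity some member \<open>F\<close> has exact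
      degree \<open>D\<close>, so reduction modulo \<open>F\<close> leads to degrees below
      \<open>D\<close>.\<close>
    define F where "F = p q0"
    have F: "degree F = D" "F \<noteq> 0"
      using q0 deg[OF q0(1)] le_degree[of F D] by (auto simp: F_def)
    define \<Phi> where "\<Phi> P = (\<Sum>j<2 * D. coeff P j * \<phi> j)" for P
    have \<Phi>_diff: "\<Phi> (P - P') = \<Phi> P - \<Phi> P'" for P P'
      by (simp add: \<Phi>_def algebra_simps sum_subtractf)
    have \<Phi>_sum: "\<Phi> (\<Sum>k\<in>K. P k) = (\<Sum>k\<in>K. \<Phi> (P k))" for P and K :: "nat set"
      unfolding \<Phi>_def by (simp add: coeff_sum sum_distrib_right) (rule sum.swap)
    have \<Phi>_smult: "\<Phi> (smult c P) = c * \<Phi> P" for c P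
      by (simp add: \<Phi>_def sum_distrib_left mult.assoc)
    have \<Phi>_mult: "\<Phi> (p q * w) = 0" if "q \<in> Q" "degree w < D" for q w
    proof -
      have "w = (\<Sum>a<D. smult (coeff w a) (monom 1 a))"
        using poly_as_sum_of_monoms'[of w "D - 1"] that(2) D
        by (simp add: smult_monom lessThan_Suc_atMost[symmetric])
      then have "p q * w = (\<Sum>a<D. smult (coeff w a) (monom 1 a * p q))"
        by (metis (no_types, lifting) mult.commute mult_smult_left sum.cong sum_distrib_left)
      then show ?thesis
        using kill[OF that(1)] by (simp add: \<Phi>_sum \<Phi>_smult) (simp add: \<Phi>_def)
    qed
    \<comment> \<open>The largest ideal on which \<open>\<Phi> (_ mod F)\<close> vanishes. It
      contains every \<open>p q\<close>, and a root of its generator will be the common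
      zero.\<close>
    define J where "J = {g. \<forall>h. \<Phi> ((g * h) mod F) = 0}"
    have pJ: "p q \<in> J" if "q \<in> Q" for q
    proof -
      have "\<Phi> ((p q * h) mod F) = 0" for h
      proof -
        \<comment> \<open>Replacing \<open>h\<close> by its remainder \<open>r\<close> does not
          change the product modulo \<open>F\<close>. The remainder of \<open>p q * r\<close> is
          \<open>p q * r - F * w\<close> with both cofactors \<open>r\<close> and \<open>w\<close>
          of degree below \<open>D\<close>, and \<open>\<Phi>\<close> kills each of the two
          terms.\<close>
        define r where "r = h mod F"
        have r: "degree r < D"
          using degree_mod_less'[OF F(2), of h] F(1) D by (cases "r = 0") (auto simp: r_def)
        define w where "w = (p q * r) div F"
        have "degree w < D"
        proof (cases "w = 0")
          case False
          have "degree (p q * r) < 2 * D"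
            using degree_mult_le[of "p q" r] deg[OF that] r by linarith
          moreover have "degree ((p q * r) mod F) < 2 * D"
            using degree_mod_less'[OF F(2), of "p q * r"] F(1) D
            by (cases "(p q * r) mod F = 0") auto
          moreover have "F * w = p q * r - (p q * r) mod F"
            by (simp add: w_def minus_mod_eq_mult_div)
          ultimately have "degree (F * w) < 2 * D"
            using degree_diff_less by metis
          then show ?thesis using F False by (simp add: degree_mult_eq)
        qed (use D in simp)
        have "(p q * h) mod F = p q * r - F * w"
          by (simp add: r_def w_def mod_mult_right_eq minus_mult_div_eq_mod)
        then show ?thesis
          using \<Phi>_mult[OF that r] \<Phi>_mult[OF q0(1) \<open>degree w < D\<close>]
          by (simp add: \<Phi>_diff F_def)
      qed
      then show ?thesis by (simp add: J_def)
    qed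
    have "g * h \<in> J" if "g \<in> J" for g h
      using that by (simp add: J_def mult.assoc)
    moreover have "g - h \<in> J" if "g \<in> J" "h \<in> J" for g h
      using that by (simp add: J_def left_diff_distrib poly_mod_diff_left \<Phi>_diff)
    ultimately obtain g where g: "g \<in> J" "g \<noteq> 0" "\<And>p. p \<in> J \<Longrightarrow> g dvd p"
      using poly_ideal_generator[of J F] pJ[OF q0(1)] F(2) by (metis F_def)
    \<comment> \<open>A constant generator would make \<open>\<Phi>\<close> vanish on all
      remainders, hence \<open>\<phi>\<close> below \<open>D\<close>. From there on the multiples of
      \<open>F\<close> by powers of \<open>X\<close>, having nonzero leading coefficient, give
      \<open>\<phi> j = 0\<close> one index after the other.\<close>
    have "degree g \<noteq> 0"
    proof
      assume "degree g = 0"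
      then obtain c where "g = [:c:]" by (rule degree_eq_zeroE)
      with g(2) have "g * [:inverse c:] = 1" by (simp add: one_pCons)
      then have "g * ([:inverse c:] * h) = h" for h
        by (metis mult.assoc mult_1)
      then have \<Phi>_mod: "\<Phi> (h mod F) = 0" for h
        using g(1) unfolding J_def by (metis (mono_tags, lifting) mem_Collect_eq)
      have "j < 2 * D \<longrightarrow> \<phi> j = 0" for j
      proof (induction j rule: less_induct)
        case (less j)
        show ?case
        proof (cases "j < D")
          case True
          then have "monom 1 j mod F = monom 1 j"
            by (intro mod_poly_less) (simp add: F degree_monom_eq)
          then have "\<Phi> (monom 1 j) = 0" using \<Phi>_mod[of "monom 1 j"] by simp
          then show ?thesis
            using True unfolding \<Phi>_def
            by (subst (asm) sum.mono_neutral_right[of _ "{j}"]) auto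
        next
          case False
          show ?thesis
          proof
            assume j: "j < 2 * D"
            have "coeff (monom 1 (j - D) * F) i * \<phi> i = 0" if "i < 2 * D" "i \<noteq> j" for i
              using that less False j F by (cases "i < j") (auto simp: coeff_monom_mult coeff_eq_0)
            then have "(\<Sum>i<2 * D. coeff (monom 1 (j - D) * F) i * \<phi> i) =
                coeff (monom 1 (j - D) * F) j * \<phi> j"
              using j by (subst sum.mono_neutral_right[of _ "{j}"]) auto
            then have "coeff F D * \<phi> j = 0"
              using kill[OF q0(1), of "j - D"] j False
              by (simp add: coeff_monom_mult F_def)
            then show "\<phi> j = 0" using q0(2) by (simp add: F_def)
          qed
        qed
      qed
      with nz show False by blast
    qed
    then obtain x where x: "poly g x = 0"
      using alg_closed_imp_poly_has_root[of g] by blast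
    have "poly (p q) x = 0" if "q \<in> Q" for q
      using g(3)[OF pJ[OF that]] x by (metis dvdE mult_eq_0_iff poly_mult)
    then show ?thesis by blast
  qed simp
qed

section \<open>Elimination along the projective line\<close>

lemma sum_list_mult_product:
  fixes F :: "'b \<Rightarrow> 'a::semiring_0"
  shows "(\<Sum>x\<leftarrow>xs. F x) * (\<Sum>y\<leftarrow>ys. G y) = (\<Sum>(x, y)\<leftarrow>List.product xs ys. F x * G y)"
  by (induction xs) (simp_all add: distrib_right sum_list_const_mult o_def)

text \<open>Separates off the homogeneous coordinates of a projective line, \<open>s\<close> at
  index \<open>True\<close> and \<open>t\<close> at index \<open>False\<close>, so that the
  coefficients in \<open>z\<close> can later serve as entries of a linear system.\<close>

lemma polyfun_expand_two:
  fixes f :: "('i + bool \<Rightarrow> 'a::comm_ring_1) \<Rightarrow> 'a"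
  assumes "polyfun f"
  shows "\<exists>m c a b. (\<forall>k. polyfun (c k)) \<and>
    (\<forall>z s t. f (case_sum z (case_bool s t)) = (\<Sum>k<(m::nat). c k z * s ^ a k * t ^ b k))"
proof -
  \<comment> \<open>In a list of terms equal exponents may occur repeatedly, so sums are
    concatenations and products run over \<open>List.product\<close>.\<close>
  have "\<exists>L. (\<forall>(c, a, b)\<in>set L. polyfun c) \<and>
    (\<forall>z s t. f (case_sum z (case_bool s t)) = (\<Sum>(c, a, b)\<leftarrow>L. c z * s ^ a * t ^ b))"
    using assms
  proof induction
    case (polyfun_const c)
    show ?case by (rule exI[of _ "[(\<lambda>z. c, 0, 0)]"]) (auto intro: polyfun.intros)
  next
    case (polyfun_var i)
    show ?case
    proof (cases i)
      case (Inl j)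
      then show ?thesis by (intro exI[of _ "[(\<lambda>z. z j, 0, 0)]"]) (auto intro: polyfun.intros)
    next
      case (Inr r)
      then show ?thesis
        by (intro exI[of _ "[(\<lambda>z. 1, if r then 1 else 0, if r then 0 else 1)]"])
           (auto intro: polyfun.intros)
    qed
  next
    case (polyfun_add f g)
    then obtain L L' where "\<forall>(c, a, b)\<in>set L. polyfun c" "\<forall>(c, a, b)\<in>set L'. polyfun c"
      "\<forall>z s t. f (case_sum z (case_bool s t)) = (\<Sum>(c, a, b)\<leftarrow>L. c z * s ^ a * t ^ b)"
      "\<forall>z s t. g (case_sum z (case_bool s t)) = (\<Sum>(c, a, b)\<leftarrow>L'. c z * s ^ a * t ^ b)"
      by blast
    then show ?case by (intro exI[of _ "L @ L'"]) auto
  next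
    case (polyfun_mult f g)
    then obtain L L' where L: "\<forall>(c, a, b)\<in>set L. polyfun c" "\<forall>(c, a, b)\<in>set L'. polyfun c"
      "\<forall>z s t. f (case_sum z (case_bool s t)) = (\<Sum>(c, a, b)\<leftarrow>L. c z * s ^ a * t ^ b)"
      "\<forall>z s t. g (case_sum z (case_bool s t)) = (\<Sum>(c, a, b)\<leftarrow>L'. c z * s ^ a * t ^ b)"
      by blast
    let ?L = "map (\<lambda>((c, a, b), (c', a', b')). (\<lambda>z. c z * c' z, a + a', b + b')) (List.product L L')"
    have "\<forall>(c, a, b)\<in>set ?L. polyfun c"
      using L(1,2) by (auto intro!: polyfun.intros(4))
    moreover have "f (case_sum z (case_bool s t)) * g (case_sum z (case_bool s t)) =
        (\<Sum>(c, a, b)\<leftarrow>?L. c z * s ^ a * t ^ b)" for z s t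
      unfolding L(3)[rule_format] L(4)[rule_format] sum_list_mult_product map_map
      by (intro arg_cong[of _ _ sum_list] map_cong refl) (auto simp: power_add mult_ac)
    ultimately show ?case by blast
  qed
  then obtain L where L: "\<forall>(c, a, b)\<in>set L. polyfun c"
    "\<And>z s t. f (case_sum z (case_bool s t)) = (\<Sum>(c, a, b)\<leftarrow>L. c z * s ^ a * t ^ b)"
    by blast
  \<comment> \<open>Padding with zero makes \<open>c k\<close> a polynomial function for every
    \<open>k\<close>.\<close>
  define c where "c k = (if k < length L then fst (L ! k) else (\<lambda>z. 0))" for k
  have "\<forall>k. polyfun (c k)"
    using L(1) by (auto intro!: polyfun.intros(1) simp: split_def c_def)
  moreover have "f (case_sum z (case_bool s t)) =
      (\<Sum>k<length L. c k z * s ^ fst (snd (L ! k)) * t ^ snd (snd (L ! k)))" for z s t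
    unfolding L(2) by (simp add: sum_list_sum_nth split_def atLeast0LessThan c_def)
  ultimately show ?thesis
    by (intro exI[of _ "length L"] exI[of _ c] exI[of _ "\<lambda>k. fst (snd (L ! k))"]
        exI[of _ "\<lambda>k. snd (snd (L ! k))"]) simp
qed


text \<open>On a cone the homogeneous components of the equations vanish separately. After
  dehomogenising, the criterion for common zeros on the projective line rewrites the existence of a
  point as the existence of a nonzero solution of a linear system whose coefficients are polynomial
  in \<open>z\<close>.\<close>

lemma zariski_closed_projective_line:
  fixes U :: "('i + bool \<Rightarrow> 'a::alg_closed_field) \<Rightarrow> bool"
  assumes "zariski_closed U"
    and cone: "\<And>z s t l. l \<noteq> 0 \<Longrightarrow> U (case_sum z (case_bool s t)) \<Longrightarrow>
                 U (case_sum z (case_bool (l * s) (l * t)))"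
  shows "zariski_closed (\<lambda>z. \<exists>s t. (s \<noteq> 0 \<or> t \<noteq> 0) \<and> U (case_sum z (case_bool s t)))"
proof -
  obtain F where F: "finite F" "\<And>f. f \<in> F \<Longrightarrow> polyfun f" "\<And>x. U x \<longleftrightarrow> (\<forall>f\<in>F. f x = 0)"
    using assms(1) by (auto simp: zariski_closed_def)
  define E where "E f m c a b \<longleftrightarrow> (\<forall>k. polyfun (c k)) \<and>
    (\<forall>z s t. f (case_sum z (case_bool s t)) = (\<Sum>k<(m::nat). c k z * s ^ a k * t ^ b k))"
    for f :: "('i + bool \<Rightarrow> 'a) \<Rightarrow> 'a" and m c a b
  have "\<forall>f\<in>F. \<exists>m c a b. E f m c a b"
    unfolding E_def by (intro ballI polyfun_expand_two F(2))
  then obtain m c a b where "\<And>f. f \<in> F \<Longrightarrow> E f (m f) (c f) (a f) (b f)"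
    by metis
  then have c: "\<And>f k. f \<in> F \<Longrightarrow> polyfun (c f k)"
    and f: "\<And>f z s t. f \<in> F \<Longrightarrow>
      f (case_sum z (case_bool s t)) = (\<Sum>k<m f. c f k z * s ^ a f k * t ^ b f k)"
    by (auto simp: E_def)
  \<comment> \<open>A bound for all total degrees; the successor ensures \<open>D > 0\<close>, which
    the criterion requires.\<close>
  define D where "D = Suc (\<Sum>f\<in>F. \<Sum>k<m f. a f k + b f k)"
  have D: "a f k + b f k \<le> D" if "f \<in> F" "k < m f" for f k
  proof -
    have "a f k + b f k \<le> (\<Sum>k<m f. a f k + b f k)"
      using that by (intro member_le_sum) auto
    also have "\<dots> \<le> (\<Sum>f\<in>F. \<Sum>k<m f. a f k + b f k)"
      using that F(1) by (intro member_le_sum[of f F "\<lambda>f. \<Sum>k<m f. a f k + b f k"]) auto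
    finally show ?thesis by (simp add: D_def)
  qed
  \<comment> \<open>\<open>K f e\<close> collects the terms of total degree \<open>e\<close>,
    \<open>H f e\<close> is the homogeneous component of that degree, and \<open>h f e\<close> is
    its dehomogenisation at \<open>s = 1\<close>.\<close>
  define K where "K f e = {k \<in> {..<m f}. a f k + b f k = e}" for f e
  define H where "H f e z s t = (\<Sum>k\<in>K f e. c f k z * s ^ a f k * t ^ b f k)" for f e z s t
  define h where "h f e z = (\<Sum>k\<in>K f e. monom (c f k z) (b f k))" for f e z
  have f_scale: "f (case_sum z (case_bool (l * s) (l * t))) = (\<Sum>e\<le>D. H f e z s t * l ^ e)"
    if "f \<in> F" for f z s t l
  proof -
    have "(\<Sum>e\<le>D. H f e z s t * l ^ e) =
        (\<Sum>e\<le>D. \<Sum>k\<in>K f e. c f k z * (l * s) ^ a f k * (l * t) ^ b f k)"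
      unfolding H_def sum_distrib_right
      by (intro sum.cong refl) (auto simp: K_def power_mult_distrib power_add)
    also have "\<dots> = (\<Sum>k<m f. c f k z * (l * s) ^ a f k * (l * t) ^ b f k)"
      unfolding K_def by (rule sum.group) (auto simp: D[OF that])
    finally show ?thesis by (simp add: f[OF that])
  qed
  have U_iff: "U (case_sum z (case_bool s t)) \<longleftrightarrow> (\<forall>f\<in>F. \<forall>e\<le>D. H f e z s t = 0)" for z s t
  proof
    assume U: "U (case_sum z (case_bool s t))"
    show "\<forall>f\<in>F. \<forall>e\<le>D. H f e z s t = 0"
    proof (intro ballI allI impI)
      fix f e assume "f \<in> F" "e \<le> D"
      \<comment> \<open>Along the line through the point, \<open>f\<close> is this polynomial in the
        scaling factor \<open>l\<close>. It vanishes at all nonzero \<open>l\<close> and the field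
        is infinite, so its coefficients are zero.\<close>
      define P where "P = (\<Sum>e\<le>D. monom (H f e z s t) e)"
      have "poly P l = 0" if "l \<noteq> 0" for l
      proof -
        have "f (case_sum z (case_bool (l * s) (l * t))) = 0"
          using cone[OF that U] F(3) \<open>f \<in> F\<close> by blast
        then show ?thesis
          using f_scale[OF \<open>f \<in> F\<close>, of z l s t] by (simp add: P_def poly_sum poly_monom)
      qed
      then have "UNIV - {0} \<subseteq> {l. poly P l = 0}" by auto
      then have "infinite {l. poly P l = 0}"
        using infinite_UNIV_alg_closed by (metis finite.emptyI finite_Diff2 finite_insert finite_subset)
      then have "P = 0" using poly_roots_finite by blast
      moreover have "coeff P e = H f e z s t"
        using \<open>e \<le> D\<close> by (simp add: P_def coeff_sum coeff_monom)
      ultimately show "H f e z s t = 0" by simp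
    qed
  next
    assume "\<forall>f\<in>F. \<forall>e\<le>D. H f e z s t = 0"
    then show "U (case_sum z (case_bool s t))"
      using f_scale[of _ z 1 s t] by (simp add: F(3))
  qed
  have h_deg: "degree (h f e z) \<le> e" for f e z
    unfolding h_def
    by (intro degree_sum_le) (auto simp: K_def intro: order.trans[OF degree_monom_le])
  have poly_h: "poly (h f e z) x = H f e z 1 x" for f e z x
    by (simp add: h_def H_def poly_sum poly_monom)
  \<comment> \<open>At \<open>s = 0\<close> only the terms with \<open>a f k = 0\<close> survive,
    that is those with \<open>b f k = e\<close>.\<close>
  have coeff_h: "coeff (h f e z) e = H f e z 0 1" for f e z
    unfolding h_def H_def coeff_sum by (intro sum.cong) (auto simp: K_def coeff_monom power_0_left)
  \<comment> \<open>All components are brought to the common degree \<open>D\<close> by multiplying with a power of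
    each of the two variables.\<close>
  define p where "p = (\<lambda>(f, e, r) z. monom 1 (if r then 0 else D - e) * h f e z)"
  define Q where "Q = F \<times> {..D} \<times> (UNIV :: bool set)"
  have p_deg: "degree (p q z) \<le> D" if "q \<in> Q" for q z
  proof -
    obtain f e r where q: "q = (f, e, r)" "e \<le> D" using \<open>q \<in> Q\<close> by (auto simp: Q_def)
    have "degree (p q z) \<le> (if r then 0 else D - e) + degree (h f e z)"
      unfolding p_def q using degree_mult_le degree_monom_le by (metis (no_types, lifting) add_le_mono1 case_prod_conv order.trans)
    then show ?thesis using h_deg[of f e z] q(2) by (auto split: if_splits)
  qed
  have Q_ball: "(\<forall>q\<in>Q. P q) \<longleftrightarrow> (\<forall>f\<in>F. \<forall>e\<le>D. P (f, e, True) \<and> P (f, e, False))" (is "?l \<longleftrightarrow> ?r") for P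
  proof
    assume ?l
    then show ?r by (simp add: Q_def)
  next
    assume r: ?r
    show ?l
    proof
      fix q assume "q \<in> Q"
      then obtain f e b where "q = (f, e, b)" "f \<in> F" "e \<le> D" by (auto simp: Q_def)
      then show "P q" using r by (cases b) auto
    qed
  qed
  \<comment> \<open>The \<open>True\<close> copies carry the factor \<open>s ^ (D - e)\<close>,
    invisible at \<open>s = 1\<close>, so they vanish exactly where the components do; the
    \<open>False\<close> copies are multiples of them.\<close>
  have root_iff: "(\<forall>q\<in>Q. poly (p q z) x = 0) \<longleftrightarrow> U (case_sum z (case_bool 1 x))" for z x
    unfolding U_iff Q_ball p_def by (auto simp: poly_h poly_monom)
  have inf_iff: "(\<forall>q\<in>Q. coeff (p q z) D = 0) \<longleftrightarrow> U (case_sum z (case_bool 0 1))" for z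
  proof -
    \<comment> \<open>At infinity the roles are exchanged: the factor \<open>t ^ (D - e)\<close> of
      a \<open>False\<close> copy is 1 there, while the factor of a \<open>True\<close> copy is 0
      unless \<open>e = D\<close>.\<close>
    have "coeff (p (f, e, False) z) D = H f e z 0 1" if "e \<le> D" for f e
      using that by (simp add: p_def coeff_monom_mult coeff_h)
    moreover have "coeff (p (f, e, True) z) D = (if e = D then H f e z 0 1 else 0)" if "e \<le> D" for f e
      using that h_deg[of f e z] by (auto simp: p_def coeff_h coeff_eq_0)
    ultimately show ?thesis
      unfolding U_iff Q_ball by simp (metis order_refl)
  qed
  have "(\<exists>s t. (s \<noteq> 0 \<or> t \<noteq> 0) \<and> U (case_sum z (case_bool s t))) \<longleftrightarrow>
      (\<exists>x. \<forall>q\<in>Q. poly (p q z) x = 0) \<or> (\<forall>q\<in>Q. coeff (p q z) D = 0)" for z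
  proof
    assume "\<exists>s t. (s \<noteq> 0 \<or> t \<noteq> 0) \<and> U (case_sum z (case_bool s t))"
    then obtain s t where st: "s \<noteq> 0 \<or> t \<noteq> 0" "U (case_sum z (case_bool s t))" by blast
    show "(\<exists>x. \<forall>q\<in>Q. poly (p q z) x = 0) \<or> (\<forall>q\<in>Q. coeff (p q z) D = 0)"
    \<comment> \<open>The cone property scales the point to \<open>(0, 1)\<close> or to
      \<open>(1, t / s)\<close>.\<close>
    proof (cases "s = 0")
      case True
      then show ?thesis using cone[OF _ st(2), of "inverse t"] st(1) by (simp add: inf_iff)
    next
      case False
      then show ?thesis using cone[OF _ st(2), of "inverse s"] by (auto simp: root_iff)
    qed
  next
    assume "(\<exists>x. \<forall>q\<in>Q. poly (p q z) x = 0) \<or> (\<forall>q\<in>Q. coeff (p q z) D = 0)"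
    then have "(\<exists>x. U (case_sum z (case_bool 1 x))) \<or> U (case_sum z (case_bool 0 1))"
      by (simp add: root_iff inf_iff)
    then show "\<exists>s t. (s \<noteq> 0 \<or> t \<noteq> 0) \<and> U (case_sum z (case_bool s t))"
      using one_neq_zero[where ?'a = 'a] by metis
  qed
  moreover have "(\<exists>x. \<forall>q\<in>Q. poly (p q z) x = 0) \<or> (\<forall>q\<in>Q. coeff (p q z) D = 0) \<longleftrightarrow>
      (\<exists>\<phi>. (\<exists>j<2 * D. \<phi> j \<noteq> 0) \<and> (\<forall>r\<in>Q \<times> {..<D}.
      (\<Sum>j<2 * D. coeff (monom 1 (snd r) * p (fst r) z) j * \<phi> j) = 0))" for z
    using common_zero_iff_functional[of Q "\<lambda>q. p q z" D] p_deg
    by (simp add: D_def split_def)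
  moreover have "zariski_closed (\<lambda>z. \<exists>\<phi>. (\<exists>j<2 * D. \<phi> j \<noteq> 0) \<and> (\<forall>r\<in>Q \<times> {..<D}.
      (\<Sum>j<2 * D. coeff (monom 1 (snd r) * p (fst r) z) j * \<phi> j) = 0))"
  proof (rule zariski_closed_kernel)
    show "finite (Q \<times> {..<D})" using F(1) by (simp add: Q_def)
    fix r j assume "r \<in> Q \<times> {..<D}"
    then obtain f e q a' where "f \<in> F" "r = ((f, e, q), a')" by (auto simp: Q_def)
    then show "polyfun (\<lambda>z. coeff (monom 1 (snd r) * p (fst r) z) j)"
      by (auto simp: p_def h_def coeff_monom_mult coeff_sum intro!: polyfun_if polyfun_sum c polyfun_const)
  qed
  ultimately show ?thesis by simp
qed

text \<open>By induction on \<open>J\<close>: a point supported in \<open>insert j0 J\<close> lies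
  on a line joining the basis vector at \<open>j0\<close> to a point \<open>y\<close> supported in
  \<open>J\<close>. The line coordinates \<open>(s, t)\<close> are eliminated first; what remains is
  a closed cone condition on \<open>y\<close>, to which the induction hypothesis applies.\<close>

lemma zariski_closed_projection:
  fixes V :: "('i + 'j \<Rightarrow> 'a::alg_closed_field) \<Rightarrow> bool"
  assumes "finite J" "zariski_closed V"
    and "\<And>z y l. l \<noteq> 0 \<Longrightarrow> V (case_sum z y) \<Longrightarrow> V (case_sum z (\<lambda>j. l * y j))"
  shows "zariski_closed (\<lambda>z. \<exists>y. (\<exists>j\<in>J. y j \<noteq> 0) \<and> (\<forall>j. j \<notin> J \<longrightarrow> y j = 0) \<and> V (case_sum z y))"
  using assms
proof (induction J arbitrary: V rule: finite_induct)
  case empty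
  then show ?case by (simp add: zariski_closed_False)
next
  case (insert j0 J)
  note cone = insert.prems(2)
  show ?case
  proof (cases "J = {}")
    \<comment> \<open>A single coordinate is treated apart, since the line construction needs a
      nonzero vector supported in \<open>J\<close>. Up to scaling, the only point is the basis
      vector itself.\<close>
    case True
    have "(\<exists>y. (\<exists>j\<in>insert j0 J. y j \<noteq> 0) \<and> (\<forall>j. j \<notin> insert j0 J \<longrightarrow> y j = 0) \<and> V (case_sum z y)) \<longleftrightarrow>
      V (\<lambda>k. case k of Inl i \<Rightarrow> z i | Inr j \<Rightarrow> if j = j0 then 1 else 0)" (is "?L \<longleftrightarrow> V ?w") for z
    proof
      assume ?L
      then obtain y where y: "y j0 \<noteq> 0" "\<And>j. j \<noteq> j0 \<Longrightarrow> y j = 0" "V (case_sum z y)"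
        using True by auto
      have "(\<lambda>j. inverse (y j0) * y j) = (\<lambda>j. if j = j0 then 1 else 0)"
        using y(1,2) by auto
      then show "V ?w" using cone[OF _ y(3), of "inverse (y j0)"] y(1) by simp
    next
      assume "V ?w"
      then show ?L using True by (intro exI[of _ "\<lambda>j. if j = j0 then 1 else 0"]) auto
    qed
    moreover have "zariski_closed (\<lambda>z. V (\<lambda>k. (case k of Inl i \<Rightarrow> \<lambda>z. z i | Inr j \<Rightarrow> \<lambda>z. if j = j0 then 1 else 0) z))"
      by (rule zariski_closed_subst[OF insert.prems(1)]) (auto split: sum.split intro: polyfun.intros)
    ultimately show ?thesis by (simp add: sum.case_distrib[of "\<lambda>f. f _"])
  next
    case False
    \<comment> \<open>The point \<open>s * y + t * e\<close> of the line, with \<open>e\<close> the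
      basis vector at \<open>j0\<close> and \<open>y\<close> the \<open>Inr\<close> part of
      \<open>x\<close>, whose own entry at \<open>j0\<close> is overwritten.\<close>
    define W where "W x s t = V (\<lambda>k. case k of Inl i \<Rightarrow> x (Inl i)
        | Inr j \<Rightarrow> if j = j0 then t else s * x (Inr j))" for x :: "'i + 'j \<Rightarrow> 'a" and s t
    define V' where "V' x \<longleftrightarrow> (\<exists>s t. (s \<noteq> 0 \<or> t \<noteq> 0) \<and> W x s t)" for x
    have W_scale: "W x (l * s) (l * t)" if "l \<noteq> 0" "W x s t" for x l s t
    proof -
      have "(\<lambda>j. l * (if j = j0 then t else s * x (Inr j))) =
          (\<lambda>j. if j = j0 then l * t else l * s * x (Inr j))"
        by (auto simp: mult.assoc)
      then show ?thesis
        using cone[OF that(1), of "\<lambda>i. x (Inl i)" "\<lambda>j. if j = j0 then t else s * x (Inr j)"] that(2)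
        by (simp add: W_def)
    qed
    let ?U = "\<lambda>w :: ('i + 'j) + bool \<Rightarrow> 'a. W (\<lambda>k. w (Inl k)) (w (Inr True)) (w (Inr False))"
    define \<phi> where "\<phi> k = (case k of Inl i \<Rightarrow> \<lambda>w :: ('i + 'j) + bool \<Rightarrow> 'a. w (Inl (Inl i))
        | Inr j \<Rightarrow> \<lambda>w. if j = j0 then w (Inr False) else w (Inr True) * w (Inl (Inr j)))"
      for k :: "'i + 'j"
    have "zariski_closed (\<lambda>w. V (\<lambda>k. \<phi> k w))"
      by (rule zariski_closed_subst[OF insert.prems(1)])
         (auto simp: \<phi>_def split: sum.split intro!: polyfun_if polyfun.intros)
    moreover have "?U w = V (\<lambda>k. \<phi> k w)" for w
      unfolding W_def by (rule arg_cong[of _ _ V]) (auto simp: \<phi>_def split: sum.split)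
    ultimately have "zariski_closed ?U" by simp
    from zariski_closed_projective_line[OF this] have "zariski_closed V'"
      unfolding V'_def using W_scale by simp
    \<comment> \<open>Rescaling \<open>y\<close> is compensated by dividing
      \<open>s\<close>.\<close>
    moreover have "V' (case_sum z (\<lambda>j. l * y j))" if l: "l \<noteq> 0" and V': "V' (case_sum z y)" for z y l
    proof -
      obtain s t where st: "s \<noteq> 0 \<or> t \<noteq> 0" "W (case_sum z y) s t"
        using V' by (auto simp: V'_def)
      have "W (case_sum z (\<lambda>j. l * y j)) (s / l) t"
      proof -
        have "s / l * (l * y j) = s * y j" for j using l by simp
        then show ?thesis using st(2) by (simp only: W_def sum.case)
      qed
      moreover have "s / l \<noteq> 0 \<or> t \<noteq> 0" using st(1) l by simp
      ultimately show ?thesis unfolding V'_def by blast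
    qed
    ultimately have "zariski_closed (\<lambda>z. \<exists>y. (\<exists>j\<in>J. y j \<noteq> 0) \<and> (\<forall>j. j \<notin> J \<longrightarrow> y j = 0) \<and> V' (case_sum z y))"
      by (rule insert.IH)
    moreover have "(\<exists>y. (\<exists>j\<in>J. y j \<noteq> 0) \<and> (\<forall>j. j \<notin> J \<longrightarrow> y j = 0) \<and> V' (case_sum z y)) \<longleftrightarrow>
      (\<exists>y. (\<exists>j\<in>insert j0 J. y j \<noteq> 0) \<and> (\<forall>j. j \<notin> insert j0 J \<longrightarrow> y j = 0) \<and> V (case_sum z y))"
      (is "?L \<longleftrightarrow> ?R") for z
    proof
      assume ?L
      then obtain y s t where y: "\<exists>j\<in>J. y j \<noteq> 0" "\<forall>j. j \<notin> J \<longrightarrow> y j = 0" "s \<noteq> 0 \<or> t \<noteq> 0"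
        and W: "W (case_sum z y) s t" by (auto simp: V'_def)
      let ?y = "\<lambda>j. if j = j0 then t else s * y j"
      have "V (case_sum z ?y)" using W unfolding W_def sum.case .
      moreover have "\<exists>j\<in>insert j0 J. ?y j \<noteq> 0"
        using y(1,3) insert.hyps(2) by (cases "t = 0") auto
      moreover have "\<forall>j. j \<notin> insert j0 J \<longrightarrow> ?y j = 0" using y(2) by auto
      ultimately show ?R by (intro exI[of _ ?y] conjI)
    next
      assume ?R
      then obtain y where y: "\<exists>j\<in>insert j0 J. y j \<noteq> 0" "\<forall>j. j \<notin> insert j0 J \<longrightarrow> y j = 0"
        "V (case_sum z y)" by blast
      show ?L
      proof (cases "\<exists>j\<in>J. y j \<noteq> 0")
        case True
        let ?y = "y(j0 := 0)"
        have eq: "(\<lambda>j. if j = j0 then y j0 else 1 * ?y j) = y" by auto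
        have "W (case_sum z ?y) 1 (y j0)"
          unfolding W_def sum.case eq by (rule y(3))
        then have "V' (case_sum z ?y)" unfolding V'_def by (metis one_neq_zero)
        moreover have "\<exists>j\<in>J. ?y j \<noteq> 0" using True insert.hyps(2) by auto
        moreover have "\<forall>j. j \<notin> J \<longrightarrow> ?y j = 0" using y(2) by auto
        ultimately show ?thesis by (intro exI[of _ ?y] conjI)
      next
        case False
        then have y0: "y j0 \<noteq> 0" "\<And>j. j \<noteq> j0 \<Longrightarrow> y j = 0" using y(1,2) by auto
        \<comment> \<open>The given point is a multiple of the basis vector at \<open>j0\<close>:
          take \<open>s = 0\<close> and any nonzero vector supported in \<open>J\<close>.\<close>
        obtain j1 where j1: "j1 \<in> J" using \<open>J \<noteq> {}\<close> by blast
        let ?y = "\<lambda>j. if j = j1 then 1 else 0"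
        have eq: "(\<lambda>j. if j = j0 then y j0 else 0 * ?y j) = y" using y0(2) by auto
        have "W (case_sum z ?y) 0 (y j0)"
          unfolding W_def sum.case eq by (rule y(3))
        then have "V' (case_sum z ?y)" unfolding V'_def using y0(1) by blast
        then show ?thesis using j1 by (intro exI[of _ ?y]) auto
      qed
    qed
    ultimately show ?thesis by simp
  qed
qed

section \<open>The commuting graph\<close>

text \<open>The number counts the intermediate matrices, so a chain with \<open>d\<close> of them
  corresponds to distance at most \<open>d + 1\<close>. Unlike a walk in the graph, a chain may
  repeat matrices and may have scalar end points.\<close>

fun commuting_chain :: "nat \<Rightarrow> nat \<Rightarrow> 'a::field mat \<Rightarrow> 'a mat \<Rightarrow> bool" where
  "commuting_chain n 0 A B \<longleftrightarrow> A * B = B * A"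
| "commuting_chain n (Suc d) A B \<longleftrightarrow>
     (\<exists>C\<in>carrier_mat n n. \<not> scalar_mat n C \<and> A * C = C * A \<and> commuting_chain n d C B)"

lemma commute_affine:
  fixes A C :: "'a::field mat"
  assumes A: "A \<in> carrier_mat n n" and C: "C \<in> carrier_mat n n" and "A * C = C * A"
  shows "(l \<cdot>\<^sub>m A + m \<cdot>\<^sub>m 1\<^sub>m n) * C = C * (l \<cdot>\<^sub>m A + m \<cdot>\<^sub>m 1\<^sub>m n)"
proof -
  have "(l \<cdot>\<^sub>m A + m \<cdot>\<^sub>m 1\<^sub>m n) * C = (l \<cdot>\<^sub>m A) * C + (m \<cdot>\<^sub>m 1\<^sub>m n) * C"
    using A C by (intro add_mult_distrib_mat) auto
  also have "\<dots> = l \<cdot>\<^sub>m (A * C) + m \<cdot>\<^sub>m C"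
    using A C by (simp add: mult_smult_assoc_mat[of _ n n _ n])
  also have "\<dots> = C * (l \<cdot>\<^sub>m A) + C * (m \<cdot>\<^sub>m 1\<^sub>m n)"
    using A C by (simp add: assms(3) mult_smult_distrib[of _ n n _ n])
  also have "\<dots> = C * (l \<cdot>\<^sub>m A + m \<cdot>\<^sub>m 1\<^sub>m n)"
    using A C by (intro mult_add_distrib_mat[symmetric]) auto
  finally show ?thesis .
qed

lemma scalar_mat_commute:
  assumes "scalar_mat n A" "C \<in> carrier_mat n n"
  shows "A * C = C * A"
  using assms by (auto simp: scalar_mat_def mult_smult_assoc_mat[of _ n n _ n] mult_smult_distrib[of _ n n _ n])

text \<open>Only the first link involves \<open>A\<close>. This invariance is what makes the
  intermediate matrices points of the projective space of matrices modulo scalars.\<close>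

lemma commuting_chain_affine:
  assumes "A \<in> carrier_mat n n" "B \<in> carrier_mat n n" "commuting_chain n d A B"
  shows "commuting_chain n d (l \<cdot>\<^sub>m A + m \<cdot>\<^sub>m 1\<^sub>m n) B"
  using assms commute_affine[OF assms(1)] by (cases d) auto

text \<open>The matrix unit at position \<open>(0, 1)\<close>, which exists since
  \<open>n \<ge> 2\<close>.\<close>

lemma ex_nonscalar:
  assumes "n \<ge> 2"
  shows "\<exists>C\<in>carrier_mat n n. \<not> scalar_mat n (C :: 'a::field mat)"
proof -
  let ?C = "mat n n (\<lambda>(i, j). if i = 0 \<and> j = 1 then 1 else 0) :: 'a mat"
  have "?C \<noteq> c \<cdot>\<^sub>m 1\<^sub>m n" for c
  proof
    assume "?C = c \<cdot>\<^sub>m 1\<^sub>m n"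
    then have "?C $$ (0, 1) = (c \<cdot>\<^sub>m 1\<^sub>m n) $$ (0, 1)" by (rule arg_cong)
    then show False using assms by simp
  qed
  then show ?thesis by (intro bexI[of _ ?C]) (auto simp: scalar_mat_def)
qed

text \<open>Copies of a nonscalar end point fill the chain; if both end points are scalar, any
  nonscalar matrix serves.\<close>

lemma commuting_chain_commute:
  fixes A B :: "'a::field mat"
  assumes n: "n \<ge> 2" and "A \<in> carrier_mat n n" "B \<in> carrier_mat n n" "A * B = B * A"
  shows "commuting_chain n d A B"
  using assms(2-)
proof (induction d arbitrary: A)
  case (Suc d)
  consider "\<not> scalar_mat n A" | "scalar_mat n A" "\<not> scalar_mat n B" | "scalar_mat n A" "scalar_mat n B"
    by blast
  then show ?case
  proof cases
    case 1
    then show ?thesis using Suc by auto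
  next
    case 2
    then show ?thesis using Suc by auto
  next
    case 3
    obtain C :: "'a mat" where C: "C \<in> carrier_mat n n" "\<not> scalar_mat n C"
      using ex_nonscalar[OF n] by blast
    then show ?thesis
      using Suc scalar_mat_commute[OF 3(1) C(1)] scalar_mat_commute[OF 3(2) C(1)] by auto
  qed
qed simp

section \<open>Distances in the commuting graph and chains\<close>

lemma graph_dist_le_iff:
  "graph_dist G u v \<le> enat d \<longleftrightarrow> (\<exists>p. pre_digraph.awalk G u p v \<and> length p \<le> d)"
proof
  let ?S = "{p. pre_digraph.awalk G u p v}"
  assume le: "graph_dist G u v \<le> enat d"
  have "?S \<noteq> {}"
  proof
    assume "?S = {}"
    then have "graph_dist G u v = \<infinity>"
      unfolding graph_dist_def by (simp only: image_empty) (simp add: Inf_enat_def)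
    with le show False by simp
  qed
  then obtain q where "q \<in> ?S" by blast
  then have "enat (length q) \<in> (\<lambda>p. enat (length p)) ` ?S" by (rule imageI)
  \<comment> \<open>The extended naturals are well ordered, so the infimum of a nonempty set is
    attained.\<close>
  then have "(INF p\<in>?S. enat (length p)) \<in> (\<lambda>p. enat (length p)) ` ?S"
    unfolding Inf_enat_def
    using LeastI[of "\<lambda>x. x \<in> (\<lambda>p. enat (length p)) ` ?S" "enat (length q)"] by auto
  then show "\<exists>p. pre_digraph.awalk G u p v \<and> length p \<le> d"
    using le by (auto simp: graph_dist_def)
next
  assume "\<exists>p. pre_digraph.awalk G u p v \<and> length p \<le> d"
  then show "graph_dist G u v \<le> enat d"
    unfolding graph_dist_def by (auto intro: INF_lower2)
qed

lemma awalk_commuting_graph_Nil_iff: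
  "pre_digraph.awalk (commuting_graph n) A [] B \<longleftrightarrow>
     A = B \<and> A \<in> carrier_mat n n \<and> \<not> scalar_mat n (A :: 'a::field mat)"
proof -
  interpret G: wf_digraph "commuting_graph n :: ('a mat, 'a mat \<times> 'a mat) pre_digraph"
    by (rule wf_commuting_graph)
  show ?thesis unfolding G.awalk_Nil_iff by (simp add: commuting_graph_def)
qed

lemma awalk_commuting_graph_Cons_iff:
  "pre_digraph.awalk (commuting_graph n) A (e # p) B \<longleftrightarrow>
     (\<exists>C. e = (A, C) \<and> e \<in> arcs (commuting_graph n) \<and>
       pre_digraph.awalk (commuting_graph n) C p (B :: 'a::field mat))"
proof -
  interpret G: wf_digraph "commuting_graph n :: ('a mat, 'a mat \<times> 'a mat) pre_digraph"
    by (rule wf_commuting_graph)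
  have "tail (commuting_graph n) e = fst e" "head (commuting_graph n) e = snd e"
    by (simp_all add: commuting_graph_def)
  then show ?thesis unfolding G.awalk_Cons_iff by (cases e) auto
qed

lemma arcs_commuting_graph:
  "(A, B) \<in> arcs (commuting_graph n) \<longleftrightarrow> A \<in> carrier_mat n n \<and> \<not> scalar_mat n A \<and>
     B \<in> carrier_mat n n \<and> \<not> scalar_mat n B \<and> A \<noteq> B \<and> A * B = B * A"
  by (simp add: commuting_graph_def)

lemmas awalk_commuting_graph_simps =
  awalk_commuting_graph_Nil_iff awalk_commuting_graph_Cons_iff arcs_commuting_graph

text \<open>Arcs join distinct vertices, so repetitions in the chain are dropped and the walk may
  become shorter.\<close>

lemma commuting_chain_awalk:
  fixes A B :: "'a::field mat"
  assumes "B \<in> carrier_mat n n" "\<not> scalar_mat n B" "A \<in> carrier_mat n n" "\<not> scalar_mat n A"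
    and "commuting_chain n d A B"
  shows "\<exists>p. pre_digraph.awalk (commuting_graph n) A p B \<and> length p \<le> Suc d"
  using assms(3-)
proof (induction d arbitrary: A)
  case 0
  show ?case
  proof (cases "A = B")
    case True
    then show ?thesis
      using 0 by (intro exI[of _ "[]"]) (simp add: awalk_commuting_graph_simps)
  next
    case False
    then show ?thesis
      using 0 assms(1,2) by (intro exI[of _ "[(A, B)]"]) (simp add: awalk_commuting_graph_simps)
  qed
next
  case (Suc d)
  then obtain C where C: "C \<in> carrier_mat n n" "\<not> scalar_mat n C" "A * C = C * A"
    "commuting_chain n d C B" by auto
  from Suc.IH[OF C(1,2,4)] obtain p
    where p: "pre_digraph.awalk (commuting_graph n) C p B" "length p \<le> Suc d" by blast
  show ?case
  proof (cases "A = C")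
    case True
    then show ?thesis using p by (intro exI[of _ p]) simp
  next
    case False
    then show ?thesis
      using C Suc.prems p by (intro exI[of _ "(A, C) # p"]) (simp add: awalk_commuting_graph_simps)
  qed
qed

text \<open>A short walk is padded at its end, since a matrix commutes with itself and is thus
  joined to itself by chains of any length.\<close>

lemma awalk_commuting_chain:
  fixes A B :: "'a::field mat"
  assumes "n \<ge> 2" "pre_digraph.awalk (commuting_graph n) A p B" "length p \<le> Suc d"
  shows "commuting_chain n d A B"
  using assms(2,3)
proof (induction p arbitrary: A d)
  case Nil
  then show ?case
    by (auto simp: awalk_commuting_graph_simps intro!: commuting_chain_commute assms(1))
next
  case (Cons e p)
  then obtain C where C: "C \<in> carrier_mat n n" "\<not> scalar_mat n C" "A * C = C * A"
    and p: "pre_digraph.awalk (commuting_graph n) C p B"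
    by (auto simp: awalk_commuting_graph_simps)
  show ?case
  proof (cases d)
    case 0
    then have "p = []" using Cons.prems(2) by simp
    then show ?thesis using p C 0 by (simp add: awalk_commuting_graph_simps)
  next
    case (Suc d')
    then show ?thesis using Cons.IH[OF p, of d'] Cons.prems(2) C by auto
  qed
qed

text \<open>If the end points are equal or one is scalar, the distance is at most 1 by convention
  and the matrices commute, so both sides hold. All other pairs are governed by walks in the
  graph.\<close>

lemma commuting_dist_le_iff_chain:
  assumes "n \<ge> 2" "A \<in> carrier_mat n n" "B \<in> carrier_mat n n"
  shows "commuting_dist n A B \<le> enat (Suc d) \<longleftrightarrow> commuting_chain n d A B"
proof (cases "A = B \<or> scalar_mat n A \<or> scalar_mat n B")
  case True
  then have "A * B = B * A"
    using scalar_mat_commute assms by metis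
  then have "commuting_chain n d A B"
    by (intro commuting_chain_commute assms)
  moreover have "commuting_dist n A B \<le> enat (Suc d)"
    using True by (auto simp: commuting_dist_def one_enat_def zero_enat_def)
  ultimately show ?thesis by simp
next
  case False
  then show ?thesis
    using awalk_commuting_chain[OF assms(1)] commuting_chain_awalk[of B n A d] assms
    by (auto simp: commuting_dist_def graph_dist_le_iff)
qed

text \<open>Nonscalar matrices are normalised by making the entry \<open>(0, 0)\<close> vanish, which represents
  them as the nonzero elements of a complement of the scalar matrices.\<close>

lemma ex_nonscalar_iff:
  fixes P :: "'a::field mat \<Rightarrow> bool"
  assumes n: "n > 0"
    and affine: "\<And>C l m. C \<in> carrier_mat n n \<Longrightarrow> P C \<Longrightarrow> P (l \<cdot>\<^sub>m C + m \<cdot>\<^sub>m 1\<^sub>m n)"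
    and J: "J = {..<n} \<times> {..<n} - {(0, 0)}"
  shows "(\<exists>C\<in>carrier_mat n n. \<not> scalar_mat n C \<and> P C) \<longleftrightarrow>
    (\<exists>y. (\<exists>j\<in>J. y j \<noteq> 0) \<and> (\<forall>j. j \<notin> J \<longrightarrow> y j = 0) \<and> P (mat n n y))"
proof
  assume "\<exists>C\<in>carrier_mat n n. \<not> scalar_mat n C \<and> P C"
  then obtain C where C: "C \<in> carrier_mat n n" "\<not> scalar_mat n C" "P C" by blast
  let ?c = "C $$ (0, 0)"
  define y where "y = (\<lambda>(i, j). if (i, j) \<in> J then C $$ (i, j) - (if i = j then ?c else 0) else 0)"
  have "mat n n y = 1 \<cdot>\<^sub>m C + (- ?c) \<cdot>\<^sub>m 1\<^sub>m n"
    using C(1) by (intro eq_matI) (auto simp: y_def J)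
  then have "P (mat n n y)"
    using affine[OF C(1,3), of 1 "- ?c"] by simp
  moreover have "\<exists>j\<in>J. y j \<noteq> 0"
  proof (rule ccontr)
    assume 0: "\<not> (\<exists>j\<in>J. y j \<noteq> 0)"
    have "C = ?c \<cdot>\<^sub>m 1\<^sub>m n"
    proof (rule eq_matI)
      fix i j assume "i < dim_row (?c \<cdot>\<^sub>m 1\<^sub>m n)" "j < dim_col (?c \<cdot>\<^sub>m 1\<^sub>m n)"
      then have ij: "i < n" "j < n" by auto
      show "C $$ (i, j) = (?c \<cdot>\<^sub>m 1\<^sub>m n) $$ (i, j)"
      proof (cases "(i, j) \<in> J")
        case True
        then have "y (i, j) = 0" using 0 by blast
        then show ?thesis using True ij by (auto simp: y_def split: if_splits)
      next
        case False
        then show ?thesis using ij by (auto simp: J)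
      qed
    qed (use C in auto)
    with C(2) show False by (auto simp: scalar_mat_def)
  qed
  moreover have "\<forall>j. j \<notin> J \<longrightarrow> y j = 0" by (auto simp: y_def)
  ultimately show "\<exists>y. (\<exists>j\<in>J. y j \<noteq> 0) \<and> (\<forall>j. j \<notin> J \<longrightarrow> y j = 0) \<and> P (mat n n y)" by blast
next
  assume "\<exists>y. (\<exists>j\<in>J. y j \<noteq> 0) \<and> (\<forall>j. j \<notin> J \<longrightarrow> y j = 0) \<and> P (mat n n y)"
  then obtain y i j where y: "(i, j) \<in> J" "y (i, j) \<noteq> 0" "\<forall>j. j \<notin> J \<longrightarrow> y j = 0" "P (mat n n y)"
    by auto
  have "\<not> scalar_mat n (mat n n y)"
  proof
    assume "scalar_mat n (mat n n y)"
    then obtain c where c: "mat n n y = c \<cdot>\<^sub>m 1\<^sub>m n" by (auto simp: scalar_mat_def)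
    have yc: "y (k, l) = (if k = l then c else 0)" if "k < n" "l < n" for k l
      using arg_cong[OF c, of "\<lambda>M. M $$ (k, l)"] that by auto
    \<comment> \<open>A scalar matrix with corner entry 0 is zero, contrary to the nonzero entry of
      \<open>y\<close>.\<close>
    have "y (0, 0) = 0" using y(3) by (simp add: J)
    then have "c = 0" using yc[of 0 0] n by simp
    then show False using y(1,2) yc[of i j] by (auto simp: J)
  qed
  then show "\<exists>C\<in>carrier_mat n n. \<not> scalar_mat n C \<and> P C"
    using y(4) by (intro bexI[of _ "mat n n y"]) auto
qed

section \<open>Closedness of the chain conditions\<close>

lemma mat_commute_iff:
  fixes a b :: "nat \<times> nat \<Rightarrow> 'a::comm_ring_1"
  shows "mat n n a * mat n n b = mat n n b * mat n n a \<longleftrightarrow>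
    (\<forall>(i, j)\<in>{..<n} \<times> {..<n}. (\<Sum>k<n. a (i, k) * b (k, j)) = (\<Sum>k<n. b (i, k) * a (k, j)))"
  unfolding mat_eq_iff by (auto simp: scalar_prod_def atLeast0LessThan)

lemma zariski_closed_commute:
  fixes \<alpha> \<beta> :: "nat \<times> nat \<Rightarrow> ('i \<Rightarrow> 'a::comm_ring_1) \<Rightarrow> 'a"
  assumes "\<And>k. polyfun (\<alpha> k)" "\<And>k. polyfun (\<beta> k)"
  shows "zariski_closed (\<lambda>x. mat n n (\<lambda>k. \<alpha> k x) * mat n n (\<lambda>k. \<beta> k x) =
    mat n n (\<lambda>k. \<beta> k x) * mat n n (\<lambda>k. \<alpha> k x))"
  unfolding mat_commute_iff split_def
  by (intro zariski_closed_ball zariski_closed_eq polyfun_sum polyfun_mult assms) auto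

text \<open>The first intermediate matrix \<open>C\<close> is the point to be eliminated: its
  commutation with \<open>A\<close> is closed, the rest of the chain from \<open>C\<close> to
  \<open>B\<close> is closed by induction, and affine invariance lets \<open>C\<close> range over
  normalised matrices only.\<close>

lemma zariski_closed_commuting_chain:
  assumes n: "n > 0"
  shows "zariski_closed (\<lambda>x :: (nat \<times> nat) + (nat \<times> nat) \<Rightarrow> 'a::alg_closed_field.
    commuting_chain n d (mat n n (\<lambda>k. x (Inl k))) (mat n n (\<lambda>k. x (Inr k))))"
proof (induction d)
  case 0
  show ?case
    unfolding commuting_chain.simps by (rule zariski_closed_commute) (rule polyfun_var)+
next
  case (Suc d)
  define J :: "(nat \<times> nat) set" where "J = {..<n} \<times> {..<n} - {(0, 0)}"
  define W where "W A B C \<longleftrightarrow> A * C = C * A \<and> commuting_chain n d C B" for A B C :: "'a mat"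
  have W_affine: "W A B (l \<cdot>\<^sub>m C + m \<cdot>\<^sub>m 1\<^sub>m n)"
    if "A \<in> carrier_mat n n" "B \<in> carrier_mat n n" "C \<in> carrier_mat n n" "W A B C" for A B C l m
    using that commute_affine[OF that(3,1)] commuting_chain_affine[OF that(3,2)]
    by (auto simp: W_def)
  define V where "V w = W (mat n n (\<lambda>k. w (Inl (Inl k)))) (mat n n (\<lambda>k. w (Inl (Inr k))))
    (mat n n (\<lambda>k. w (Inr k)))" for w :: "((nat \<times> nat) + (nat \<times> nat)) + (nat \<times> nat) \<Rightarrow> 'a"
  have "zariski_closed V"
  proof -
    \<comment> \<open>The induction hypothesis is applied with the variables of \<open>C\<close> in
      place of those of \<open>A\<close>.\<close>
    define \<phi> where "\<phi> = case_sum (\<lambda>k w. w (Inr k))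
      (\<lambda>k (w :: ((nat \<times> nat) + (nat \<times> nat)) + (nat \<times> nat) \<Rightarrow> 'a). w (Inl (Inr k)))"
    have "zariski_closed (\<lambda>w. commuting_chain n d (mat n n (\<lambda>k. \<phi> (Inl k) w)) (mat n n (\<lambda>k. \<phi> (Inr k) w)))"
      by (rule zariski_closed_subst[OF Suc.IH, of \<phi>])
         (auto simp: \<phi>_def split: sum.split intro: polyfun_var)
    then have "zariski_closed (\<lambda>w :: ((nat \<times> nat) + (nat \<times> nat)) + (nat \<times> nat) \<Rightarrow> 'a.
        commuting_chain n d (mat n n (\<lambda>k. w (Inr k))) (mat n n (\<lambda>k. w (Inl (Inr k)))))"
      by (simp add: \<phi>_def)
    then show ?thesis
      unfolding V_def W_def
      by (intro zariski_closed_conj zariski_closed_commute polyfun_var)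
  qed
  moreover have "V (case_sum z (\<lambda>j. l * y j))" if "V (case_sum z y)" for z y l
  proof -
    have "mat n n (\<lambda>j. l * y j) = l \<cdot>\<^sub>m mat n n y + 0 \<cdot>\<^sub>m 1\<^sub>m n"
      by (intro eq_matI) auto
    then show ?thesis
      using W_affine[of _ _ "mat n n y" l 0] that unfolding V_def sum.case by simp
  qed
  ultimately have "zariski_closed (\<lambda>z. \<exists>y. (\<exists>j\<in>J. y j \<noteq> 0) \<and> (\<forall>j. j \<notin> J \<longrightarrow> y j = 0) \<and> V (case_sum z y))"
    by (intro zariski_closed_projection) (auto simp: J_def)
  moreover have "commuting_chain n (Suc d) (mat n n (\<lambda>k. z (Inl k))) (mat n n (\<lambda>k. z (Inr k))) \<longleftrightarrow>
      (\<exists>y. (\<exists>j\<in>J. y j \<noteq> 0) \<and> (\<forall>j. j \<notin> J \<longrightarrow> y j = 0) \<and> V (case_sum z y))" for z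
  proof -
    have "(\<exists>C\<in>carrier_mat n n. \<not> scalar_mat n C \<and> W (mat n n (\<lambda>k. z (Inl k))) (mat n n (\<lambda>k. z (Inr k))) C) \<longleftrightarrow>
      (\<exists>y. (\<exists>j\<in>J. y j \<noteq> 0) \<and> (\<forall>j. j \<notin> J \<longrightarrow> y j = 0) \<and>
        W (mat n n (\<lambda>k. z (Inl k))) (mat n n (\<lambda>k. z (Inr k))) (mat n n y))"
      by (rule ex_nonscalar_iff[OF n _ J_def]) (rule W_affine, auto)
    then show ?thesis
      unfolding V_def sum.case commuting_chain.simps W_def .
  qed
  ultimately show ?case by simp
qed

text \<open>The commutator is linear in \<open>y\<close>. Row \<open>r\<close> is its entry at
  position \<open>r\<close>, to which \<open>y k\<close> contributes through \<open>a * y\<close> if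
  \<open>k\<close> lies in the column of \<open>r\<close>, and through \<open>y * a\<close> if
  \<open>k\<close> lies in the row of \<open>r\<close>.\<close>

lemma mat_commute_linear:
  fixes a y :: "nat \<times> nat \<Rightarrow> 'a::comm_ring_1"
  assumes J: "J = {..<n} \<times> {..<n} - {(0, 0)}" and y: "\<And>j. j \<notin> J \<Longrightarrow> y j = 0"
  shows "mat n n a * mat n n y = mat n n y * mat n n a \<longleftrightarrow>
    (\<forall>r\<in>{..<n} \<times> {..<n}. (\<Sum>k\<in>J. ((if snd k = snd r then a (fst r, fst k) else 0) -
        (if fst k = fst r then a (snd k, snd r) else 0)) * y k) = 0)"
proof -
  have "(\<Sum>k\<in>J. ((if snd k = j then a (i, fst k) else 0) - (if fst k = i then a (snd k, j) else 0)) * y k) =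
    (\<Sum>k<n. a (i, k) * y (k, j)) - (\<Sum>k<n. y (i, k) * a (k, j))" if ij: "i < n" "j < n" for i j
  proof -
    have "(\<Sum>k\<in>J. ((if snd k = j then a (i, fst k) else 0) - (if fst k = i then a (snd k, j) else 0)) * y k) =
      (\<Sum>k\<in>{..<n} \<times> {..<n}. ((if snd k = j then a (i, fst k) else 0) -
        (if fst k = i then a (snd k, j) else 0)) * y k)"
      by (rule sum.mono_neutral_left) (auto simp: J y)
    also have "\<dots> = (\<Sum>k\<in>{..<n} \<times> {..<n}. if snd k = j then a (i, fst k) * y k else 0) -
        (\<Sum>k\<in>{..<n} \<times> {..<n}. if fst k = i then a (snd k, j) * y k else 0)"
      unfolding sum_subtractf[symmetric] by (rule sum.cong) (auto simp: algebra_simps)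
    also have "(\<Sum>k\<in>{..<n} \<times> {..<n}. if snd k = j then a (i, fst k) * y k else 0) =
        (\<Sum>k<n. a (i, k) * y (k, j))"
      using ij by (simp add: sum.cartesian_product' )
    also have "(\<Sum>k\<in>{..<n} \<times> {..<n}. if fst k = i then a (snd k, j) * y k else 0) =
        (\<Sum>k<n. y (i, k) * a (k, j))"
      using ij by (simp add: sum.cartesian_product') (subst sum.swap, simp add: mult.commute)
    finally show ?thesis .
  qed
  note linear = this
  show ?thesis
    unfolding mat_commute_iff split_def
  proof (intro ball_cong refl)
    fix r :: "nat \<times> nat" assume "r \<in> {..<n} \<times> {..<n}"
    then have "fst r < n" "snd r < n" by auto
    from linear[OF this] show "(\<Sum>k<n. a (fst r, k) * y (k, snd r)) = (\<Sum>k<n. y (fst r, k) * a (k, snd r)) \<longleftrightarrow>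
      (\<Sum>k\<in>J. ((if snd k = snd r then a (fst r, fst k) else 0) -
        (if fst k = fst r then a (snd k, snd r) else 0)) * y k) = 0" by simp
  qed
qed

text \<open>Commutation of the middle matrix with both end points is linear in its entries, so the
  vanishing of minors decides it over every field.\<close>

lemma zariski_closed_common_neighbour:
  assumes n: "n > 0"
  shows "zariski_closed (\<lambda>x :: (nat \<times> nat) + (nat \<times> nat) \<Rightarrow> 'a::field.
    commuting_chain n 1 (mat n n (\<lambda>k. x (Inl k))) (mat n n (\<lambda>k. x (Inr k))))"
proof -
  define J :: "(nat \<times> nat) set" where "J = {..<n} \<times> {..<n} - {(0, 0)}"
  define L where "L a r k = (if snd k = snd r then a (fst r, fst k) else 0) -
      (if fst k = fst r then a (snd k, snd r) else 0)" for a :: "nat \<times> nat \<Rightarrow> 'a" and r k :: "nat \<times> nat"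
  \<comment> \<open>The Boolean selects between the equations for the first and for the second end
    point.\<close>
  define M where "M r k x = L (\<lambda>k. x (if fst r then Inl k else Inr k)) (snd r) k"
    for r :: "bool \<times> nat \<times> nat" and k and x :: "(nat \<times> nat) + (nat \<times> nat) \<Rightarrow> 'a"
  let ?R = "(UNIV :: bool set) \<times> ({..<n} \<times> {..<n})"
  have "commuting_chain n 1 (mat n n (\<lambda>k. x (Inl k))) (mat n n (\<lambda>k. x (Inr k))) \<longleftrightarrow>
      (\<exists>y. (\<exists>j\<in>J. y j \<noteq> 0) \<and> (\<forall>r\<in>?R. (\<Sum>k\<in>J. M r k x * y k) = 0))" for x
  proof -
    define A where "A = mat n n (\<lambda>k. x (Inl k))"
    define B where "B = mat n n (\<lambda>k. x (Inr k))"
    have AB: "A \<in> carrier_mat n n" "B \<in> carrier_mat n n" by (simp_all add: A_def B_def)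
    have "commuting_chain n 1 A B \<longleftrightarrow> (\<exists>C\<in>carrier_mat n n. \<not> scalar_mat n C \<and> (A * C = C * A \<and> B * C = C * B))"
      by (auto simp: One_nat_def eq_commute)
    also have "\<dots> \<longleftrightarrow> (\<exists>y. (\<exists>j\<in>J. y j \<noteq> 0) \<and> (\<forall>j. j \<notin> J \<longrightarrow> y j = 0) \<and>
        (A * mat n n y = mat n n y * A \<and> B * mat n n y = mat n n y * B))"
      by (rule ex_nonscalar_iff[OF n _ J_def]) (metis AB commute_affine)
    also have "\<dots> \<longleftrightarrow> (\<exists>y. (\<exists>j\<in>J. y j \<noteq> 0) \<and> (\<forall>j. j \<notin> J \<longrightarrow> y j = 0) \<and> (\<forall>r\<in>?R. (\<Sum>k\<in>J. M r k x * y k) = 0))"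
    proof -
      have "(A * mat n n y = mat n n y * A \<and> B * mat n n y = mat n n y * B) \<longleftrightarrow>
          (\<forall>r\<in>?R. (\<Sum>k\<in>J. M r k x * y k) = 0)" if "\<forall>j. j \<notin> J \<longrightarrow> y j = 0" for y
      proof -
        have y: "\<And>j. j \<notin> J \<Longrightarrow> y j = 0" using that by blast
        have "A * mat n n y = mat n n y * A \<longleftrightarrow>
            (\<forall>r\<in>{..<n} \<times> {..<n}. (\<Sum>k\<in>J. M (True, r) k x * y k) = 0)"
          unfolding A_def M_def L_def fst_conv snd_conv if_True if_False
          by (rule mat_commute_linear[OF J_def]) (rule y)
        moreover have "B * mat n n y = mat n n y * B \<longleftrightarrow>
            (\<forall>r\<in>{..<n} \<times> {..<n}. (\<Sum>k\<in>J. M (False, r) k x * y k) = 0)"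
          unfolding B_def M_def L_def fst_conv snd_conv if_True if_False
          by (rule mat_commute_linear[OF J_def]) (rule y)
        moreover have "(\<forall>r\<in>?R. Q r) \<longleftrightarrow> (\<forall>b. \<forall>r\<in>{..<n} \<times> {..<n}. Q (b, r))" for Q
          by auto
        ultimately show ?thesis by (simp only: all_bool_eq)
      qed
      then show ?thesis by (intro arg_cong[of _ _ Ex] ext conj_cong refl)
    qed
    \<comment> \<open>Entries outside \<open>J\<close> do not occur in the system, so a solution may
      be cut off to \<open>J\<close>.\<close>
    also have "\<dots> \<longleftrightarrow> (\<exists>y. (\<exists>j\<in>J. y j \<noteq> 0) \<and> (\<forall>r\<in>?R. (\<Sum>k\<in>J. M r k x * y k) = 0))" (is "?l \<longleftrightarrow> ?r")
    proof
      assume ?r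
      then obtain y where y: "\<exists>j\<in>J. y j \<noteq> 0" "\<forall>r\<in>?R. (\<Sum>k\<in>J. M r k x * y k) = 0" by blast
      let ?y = "\<lambda>k. if k \<in> J then y k else 0"
      have "(\<Sum>k\<in>J. M r k x * ?y k) = (\<Sum>k\<in>J. M r k x * y k)" for r
        by (rule sum.cong) auto
      then show ?l using y by (intro exI[of _ ?y]) auto
    qed blast
    finally show ?thesis by (simp add: A_def B_def)
  qed
  moreover have "zariski_closed (\<lambda>x. \<exists>y. (\<exists>j\<in>J. y j \<noteq> 0) \<and> (\<forall>r\<in>?R. (\<Sum>k\<in>J. M r k x * y k) = 0))"
    by (rule zariski_closed_kernel_set)
       (auto simp: J_def M_def L_def intro!: polyfun_diff polyfun_if polyfun_var polyfun_const)
  ultimately show ?thesis by simp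
qed

section \<open>Transport to the coordinate space\<close>

lemma affine_variety_mat_pairs:
  fixes P :: "'a::field mat \<Rightarrow> 'a mat \<Rightarrow> bool"
  assumes "zariski_closed (\<lambda>x. P (mat n n (\<lambda>k. x (Inl k))) (mat n n (\<lambda>k. x (Inr k))))"
    and S: "S = {(A, B). A \<in> carrier_mat n n \<and> B \<in> carrier_mat n n \<and> P A B}"
  shows "affine_variety (2 * n\<^sup>2) (mat_pair_coords n ` S)"
proof -
  \<comment> \<open>Locates each matrix entry in the coordinate vector. Positions outside the matrix
    get the zero polynomial, so that every variable is a polynomial in the
    \<open>2 * n\<^sup>2\<close> coordinates.\<close>
  define \<phi> where "\<phi> = case_sum
      (\<lambda>(i, j) (x :: nat \<Rightarrow> 'a). if i < n \<and> j < n then x (i * n + j) else 0)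
      (\<lambda>(i, j) x. if i < n \<and> j < n then x (n\<^sup>2 + (i * n + j)) else 0)"
  have lt: "i * n + j < n\<^sup>2" if "i < n" "j < n" for i j
  proof -
    have "i * n + j < Suc i * n" using that by simp
    also have "\<dots> \<le> n * n" using that by (intro mult_le_mono1) simp
    finally show ?thesis by (simp add: power2_eq_square)
  qed
  have "mpoly_fun (2 * n\<^sup>2) (\<phi> k)" for k
  proof (cases k)
    case (Inl ij)
    then show ?thesis
      by (cases ij; cases "fst ij < n \<and> snd ij < n")
         (auto simp: \<phi>_def intro!: mpoly_fun_const mpoly_fun_var dest: lt)
  next
    case (Inr ij)
    then show ?thesis
      by (cases ij; cases "fst ij < n \<and> snd ij < n")
         (auto simp: \<phi>_def intro!: mpoly_fun_const mpoly_fun_var dest: lt)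
  qed
  from affine_variety_zariski_closed[OF assms(1) this]
  have "affine_variety (2 * n\<^sup>2) {v \<in> carrier_vec (2 * n\<^sup>2).
      P (mat n n (\<lambda>k. \<phi> (Inl k) (($) v))) (mat n n (\<lambda>k. \<phi> (Inr k) (($) v)))}" .
  moreover have "mat_pair_coords n ` S = {v \<in> carrier_vec (2 * n\<^sup>2).
      P (mat n n (\<lambda>k. \<phi> (Inl k) (($) v))) (mat n n (\<lambda>k. \<phi> (Inr k) (($) v)))}" (is "_ = ?V")
  proof -
    have coords: "mat n n (\<lambda>k. \<phi> (Inl k) (($) (mat_pair_coords n (A, B)))) = A"
        "mat n n (\<lambda>k. \<phi> (Inr k) (($) (mat_pair_coords n (A, B)))) = B"
      if "A \<in> carrier_mat n n" "B \<in> carrier_mat n n" for A B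
    proof -
      have "i * n + j < n\<^sup>2 + n\<^sup>2" if "i < n" "j < n" for i j
        using lt[OF that] by linarith
      then show "mat n n (\<lambda>k. \<phi> (Inl k) (($) (mat_pair_coords n (A, B)))) = A"
        "mat n n (\<lambda>k. \<phi> (Inr k) (($) (mat_pair_coords n (A, B)))) = B"
        using that by (auto intro!: eq_matI simp: \<phi>_def mat_pair_coords_def lt)
    qed
    note bij = bij_betw_mat_pair_coords[of n, where ?'a = 'a]
    show ?thesis
    proof (intro equalityI subsetI)
      fix v assume "v \<in> mat_pair_coords n ` S"
      then obtain A B where AB: "A \<in> carrier_mat n n" "B \<in> carrier_mat n n" "P A B"
        "v = mat_pair_coords n (A, B)" by (auto simp: S)
      have "v \<in> carrier_vec (2 * n\<^sup>2)"
        using bij_betw_apply[OF bij, of "(A, B)"] AB by simp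
      then show "v \<in> ?V" using AB coords by simp
    next
      fix v assume v: "v \<in> ?V"
      then have "v \<in> mat_pair_coords n ` (carrier_mat n n \<times> carrier_mat n n)"
        using bij by (simp add: bij_betw_def)
      then obtain A B where AB: "A \<in> carrier_mat n n" "B \<in> carrier_mat n n"
        "v = mat_pair_coords n (A, B)" by auto
      then have "P A B" using v coords by simp
      then show "v \<in> mat_pair_coords n ` S" using AB by (auto simp: S)
    qed
  qed
  ultimately show ?thesis by simp
qed

lemma affine_variety_dist_0:
  "affine_variety (2 * n\<^sup>2) (mat_pair_coords n ` (commuting_dist_set n 0 :: ('a::field mat \<times> 'a mat) set))"
proof (rule affine_variety_mat_pairs)
  have "mat n n (\<lambda>k. x (Inl k)) = mat n n (\<lambda>k. x (Inr k)) \<longleftrightarrow>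
      (\<forall>k\<in>{..<n} \<times> {..<n}. x (Inl k) = x (Inr k))" for x :: "(nat \<times> nat) + (nat \<times> nat) \<Rightarrow> 'a"
    unfolding mat_eq_iff by auto
  moreover have "zariski_closed (\<lambda>x :: (nat \<times> nat) + (nat \<times> nat) \<Rightarrow> 'a.
      \<forall>k\<in>{..<n} \<times> {..<n}. x (Inl k) = x (Inr k))"
    by (intro zariski_closed_ball zariski_closed_eq polyfun_var) auto
  ultimately show "zariski_closed (\<lambda>x :: (nat \<times> nat) + (nat \<times> nat) \<Rightarrow> 'a.
      mat n n (\<lambda>k. x (Inl k)) = mat n n (\<lambda>k. x (Inr k)))" by simp
  \<comment> \<open>An empty walk has equal end points; distinct pairs with a scalar member have
    distance 1 by convention.\<close>
  have "\<not> graph_dist (commuting_graph n) A B \<le> enat 0" if "A \<noteq> B" for A B :: "'a mat"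
    using that by (auto simp: graph_dist_le_iff awalk_commuting_graph_simps)
  then show "commuting_dist_set n 0 =
      {(A, B). A \<in> carrier_mat n n \<and> B \<in> carrier_mat n n \<and> A = (B :: 'a mat)}"
    by (auto simp: commuting_dist_set_def commuting_dist_def one_enat_def zero_enat_def split: if_splits)
qed

lemma affine_variety_dist_Suc:
  assumes "n \<ge> 2"
    and "zariski_closed (\<lambda>x :: (nat \<times> nat) + (nat \<times> nat) \<Rightarrow> 'a::field.
      commuting_chain n d (mat n n (\<lambda>k. x (Inl k))) (mat n n (\<lambda>k. x (Inr k))))"
  shows "affine_variety (2 * n\<^sup>2)
    (mat_pair_coords n ` (commuting_dist_set n (Suc d) :: ('a mat \<times> 'a mat) set))"
  by (rule affine_variety_mat_pairs[OF assms(2)])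
     (auto simp: commuting_dist_set_def commuting_dist_le_iff_chain[OF assms(1)])

theorem theorem1p1:
  fixes n :: nat
  assumes "n \<ge> 2"
  shows "(\<forall>d. affine_variety (2 * n\<^sup>2)
            (mat_pair_coords n ` (commuting_dist_set n d :: ('k::alg_closed_field mat \<times> 'k mat) set)))
       \<and> (\<forall>d\<le>2. affine_variety (2 * n\<^sup>2)
            (mat_pair_coords n ` (commuting_dist_set n d :: ('f::field mat \<times> 'f mat) set)))"
proof (intro conjI allI impI)
  fix d
  show "affine_variety (2 * n\<^sup>2)
      (mat_pair_coords n ` (commuting_dist_set n d :: ('k mat \<times> 'k mat) set))"
  proof (cases d)
    case 0
    then show ?thesis by (simp add: affine_variety_dist_0)
  next
    case (Suc d')
    with assms show ?thesis
      by (simp add: affine_variety_dist_Suc zariski_closed_commuting_chain)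
  qed
next
  fix d :: nat
  assume "d \<le> 2"
  then consider "d = 0" | "d = Suc 0" | "d = Suc 1" by linarith
  then show "affine_variety (2 * n\<^sup>2)
      (mat_pair_coords n ` (commuting_dist_set n d :: ('f mat \<times> 'f mat) set))"
  proof cases
    case 1
    then show ?thesis by (simp add: affine_variety_dist_0)
  next
    case 2
    \<comment> \<open>Distance at most 1 is plain commutation, a chain without intermediate
      matrices.\<close>
    have "zariski_closed (\<lambda>x :: (nat \<times> nat) + (nat \<times> nat) \<Rightarrow> 'f.
        commuting_chain n 0 (mat n n (\<lambda>k. x (Inl k))) (mat n n (\<lambda>k. x (Inr k))))"
      unfolding commuting_chain.simps by (rule zariski_closed_commute) (rule polyfun_var)+
    then show ?thesis unfolding 2 by (rule affine_variety_dist_Suc[OF assms])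
  next
    case 3
    show ?thesis
      unfolding 3
      by (rule affine_variety_dist_Suc[OF assms zariski_closed_common_neighbour]) (use assms in simp)
  qed
qed

end
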